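(* Let $n\ge 4$, let $A\in \mathrm{M}_{n-1}\mathbb{R}$, let $\eta$ be one of the three matrices (a), (b), (c) of the context, and let $g_{A,\eta}$ be the corresponding Lorentzian metric on $\mathbb{R}^n$. If $g_{A,\eta}$ is Ricci-flat and non-flat, then, up to isometry, the pair $(\eta,A)$ is one of the following three: (1) $\eta$ is the matrix (b) and $$A=\begin{bmatrix}\alpha&-\beta\\ \beta&\alpha\end{bmatrix}\oplus\mathrm{Diag}(\lambda_3,\dots,\lambda_{n-1});$$ (2) $\eta$ is the matrix (b) and $$A=\begin{bmatrix}-\delta&-\delta&-1\\ \delta&\delta&1\\ 1&1&0\end{bmatrix}\oplus O_{n-4};$$ (3) $\eta$ is the matrix (c) and $$A=\begin{bmatrix}A'&\bm 0\\ \bm c^T&1\end{bmatrix};$$ where $\alpha\le 0$, $\beta>0$, $\lambda_3,\dots,\lambda_{n-1},\delta\in\mathbb{R}$, $A'\in\mathrm{M}_{n-2}\mathbb{R}$, $\bm c\in\mathbb{R}^{n-2}$. In all other cases, a Ricci-flat metric $g_{A,\eta}$ must be flat.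
   Context: $\mathrm{M}_m\mathbb{R}$ is the set of real $m\times m$ matrices and $O_m$ the zero $m\times m$ matrix. Consider the following symmetric $n\times n$ matrices: (a) $\eta=\mathrm{Diag}(1,\dots,1,-1)$; (b) $\eta=\mathrm{Diag}(-1,1,\dots,1)$; (c) $\eta=I_{n-2}\oplus\begin{bmatrix}0&1\\1&0\end{bmatrix}$. For $A\in\mathrm{M}_{n-1}\mathbb{R}$, the metric $g_{A,\eta}$ on $\mathbb{R}^n$ with coordinates $x_1,\dots,x_n$ is $$g_{A,\eta}=d\bm{x}^T\begin{bmatrix} e^{-A^Tx_n}&\bm 0\\ \bm 0^T&1\end{bmatrix}\eta\begin{bmatrix} e^{-Ax_n}&\bm 0\\ \bm 0^T&1\end{bmatrix}d\bm{x},\qquad d\bm{x}=(dx_1,\dots,dx_n)^T.$$ It is the general left-invariant Lorentzian metric of a simply connected almost abelian Lie group. "Up to isometry, $(\eta,A)$ is one of the following" means that $g_{A,\eta}$ is isometric to $g_{\overline{A},\overline{\eta}}$ for a pair $(\overline\eta,\overline A)$ in the list. *)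

theory Defs
  imports "HOL-Analysis.Analysis" "Jordan_Normal_Form.Matrix"
begin

no_notation vec_index (infixl "$" 100)

section \<open>Pseudo-Riemannian metrics on the space of n-tuples of reals\<close>

text \<open>A metric is given by its Gram matrix in the standard coordinates: the entry \<open>g x $ i $ j\<close> is
  the coefficient of \<open>dx\<^sub>i dx\<^sub>j\<close> at \<open>x\<close>.\<close>

type_synonym 'n metric = "real ^ 'n \<Rightarrow> real ^ 'n ^ 'n"

definition partial :: "'n::finite \<Rightarrow> (real ^ 'n \<Rightarrow> real) \<Rightarrow> real ^ 'n \<Rightarrow> real" where
  "partial i f x = frechet_derivative f (at x) (axis i 1)"

text \<open>\<open>christoffel g k i j\<close> is the coefficient with upper index \<open>k\<close> of the Levi-Civita
  connection.\<close>

definition christoffel :: "'n::finite metric \<Rightarrow> 'n \<Rightarrow> 'n \<Rightarrow> 'n \<Rightarrow> real ^ 'n \<Rightarrow> real" where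
  "christoffel g k i j x =
     (1/2) * (\<Sum>l\<in>UNIV. matrix_inv (g x) $ k $ l *
       (partial i (\<lambda>y. g y $ j $ l) x + partial j (\<lambda>y. g y $ i $ l) x - partial l (\<lambda>y. g y $ i $ j) x))"

text \<open>\<open>riemann g l k i j\<close> is the coefficient of \<open>\<partial>\<^sub>l\<close> in
  \<open>R(\<partial>\<^sub>i, \<partial>\<^sub>j) \<partial>\<^sub>k\<close>, where \<open>R(X,Y) = [\<nabla>\<^sub>X, \<nabla>\<^sub>Y] - \<nabla>\<^bsub>[X,Y]\<^esub>\<close>.\<close>

definition riemann :: "'n::finite metric \<Rightarrow> 'n \<Rightarrow> 'n \<Rightarrow> 'n \<Rightarrow> 'n \<Rightarrow> real ^ 'n \<Rightarrow> real" where
  "riemann g l k i j x =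
     partial i (christoffel g l j k) x - partial j (christoffel g l i k) x
     + (\<Sum>m\<in>UNIV. christoffel g l i m x * christoffel g m j k x
                 - christoffel g l j m x * christoffel g m i k x)"

definition ricci :: "'n::finite metric \<Rightarrow> 'n \<Rightarrow> 'n \<Rightarrow> real ^ 'n \<Rightarrow> real" where
  "ricci g k j x = (\<Sum>i\<in>UNIV. riemann g i k i j x)"

definition flat :: "'n::finite metric \<Rightarrow> bool" where
  "flat g \<longleftrightarrow> (\<forall>l k i j x. riemann g l k i j x = 0)"

definition ricci_flat :: "'n::finite metric \<Rightarrow> bool" where
  "ricci_flat g \<longleftrightarrow> (\<forall>k j x. ricci g k j x = 0)"

primrec C_diff :: "nat \<Rightarrow> ('a::real_normed_vector \<Rightarrow> 'b::real_normed_vector) \<Rightarrow> bool" where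
  "C_diff 0 f \<longleftrightarrow> continuous_on UNIV f"
| "C_diff (Suc k) f \<longleftrightarrow>
     (\<forall>x. f differentiable (at x)) \<and> (\<forall>v. C_diff k (\<lambda>x. frechet_derivative f (at x) v))"

definition smooth :: "('a::real_normed_vector \<Rightarrow> 'b::real_normed_vector) \<Rightarrow> bool" where
  "smooth f \<longleftrightarrow> (\<forall>k. C_diff k f)"

definition diffeomorphism :: "('a::real_normed_vector \<Rightarrow> 'a) \<Rightarrow> bool" where
  "diffeomorphism \<phi> \<longleftrightarrow> bij \<phi> \<and> smooth \<phi> \<and> smooth (inv_into UNIV \<phi>)"

definition pullback :: "(real ^ 'n \<Rightarrow> real ^ 'n) \<Rightarrow> 'n::finite metric \<Rightarrow> 'n metric" where
  "pullback \<phi> h x =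
     (let J = matrix (frechet_derivative \<phi> (at x))
      in Finite_Cartesian_Product.transpose J ** h (\<phi> x) ** J)"

definition isometric :: "'n::finite metric \<Rightarrow> 'n metric \<Rightarrow> bool" where
  "isometric g h \<longleftrightarrow> (\<exists>\<phi>. diffeomorphism \<phi> \<and> pullback \<phi> h = g)"


section \<open>The metrics of almost abelian Lie groups\<close>

definition mat_exp :: "real mat \<Rightarrow> real mat" where
  "mat_exp A = Matrix.mat (dim_row A) (dim_row A) (\<lambda>(i,j). \<Sum>k. (A ^\<^sub>m k) $$ (i,j) / fact k)"

definition eta_a :: "nat \<Rightarrow> real mat" where
  "eta_a n = mat_diag n (\<lambda>i. if i = n - 1 then -1 else 1)"

definition eta_b :: "nat \<Rightarrow> real mat" where
  "eta_b n = mat_diag n (\<lambda>i. if i = 0 then -1 else 1)"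

definition eta_c :: "nat \<Rightarrow> real mat" where
  "eta_c n = diag_block_mat [1\<^sub>m (n - 2), mat_of_rows_list 2 [[0, 1], [1, 0]]]"

definition expand :: "real mat \<Rightarrow> real mat" where
  "expand B = diag_block_mat [B, 1\<^sub>m 1]"

text \<open>The matrices are indexed by \<open>0, \<dots>, n - 1\<close>, whereas points are indexed by a finite type. The
  bijection \<open>idx\<close> onto \<open>{0..<n}\<close> numbers the coordinates: \<open>x\<^sub>k\<close> is the one with \<open>idx\<close> value
  \<open>k - 1\<close>.\<close>

definition metric_of :: "('n::finite \<Rightarrow> nat) \<Rightarrow> real mat \<Rightarrow> real mat \<Rightarrow> 'n metric" where
  "metric_of idx A \<eta> x =
     (let n = CARD('n);
          t = x $ inv_into UNIV idx (n - 1);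
          G = expand (mat_exp ((- t) \<cdot>\<^sub>m transpose_mat A)) * \<eta> * expand (mat_exp ((- t) \<cdot>\<^sub>m A))
      in (\<chi> i j. G $$ (idx i, idx j)))"

definition listed_1 :: "nat \<Rightarrow> real mat \<Rightarrow> real mat \<Rightarrow> bool" where
  "listed_1 n \<eta> A \<longleftrightarrow> \<eta> = eta_b n \<and>
     (\<exists>\<alpha> \<beta> lam. \<alpha> \<le> 0 \<and> \<beta> > 0 \<and>
        A = diag_block_mat
              [mat_of_rows_list 2 [[\<alpha>, - \<beta>],
                                   [\<beta>,   \<alpha>]],
               mat_diag (n - 3) (\<lambda>i. lam (i + 3))])"

definition listed_2 :: "nat \<Rightarrow> real mat \<Rightarrow> real mat \<Rightarrow> bool" where
  "listed_2 n \<eta> A \<longleftrightarrow> \<eta> = eta_b n \<and>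
     (\<exists>\<delta>. A = diag_block_mat
              [mat_of_rows_list 3 [[- \<delta>, - \<delta>, - 1],
                                   [  \<delta>,   \<delta>,   1],
                                   [  1,   1,   0]],
               0\<^sub>m (n - 4) (n - 4)])"

definition listed_3 :: "nat \<Rightarrow> real mat \<Rightarrow> real mat \<Rightarrow> bool" where
  "listed_3 n \<eta> A \<longleftrightarrow> \<eta> = eta_c n \<and>
     (\<exists>A' c. A' \<in> carrier_mat (n - 2) (n - 2) \<and> c \<in> carrier_vec (n - 2) \<and>
        A = four_block_mat A'                      (0\<^sub>m (n - 2) 1)
                           (mat_of_rows (n - 2) [c]) (1\<^sub>m 1))"

definition isometric_to_listed :: "('n::finite \<Rightarrow> nat) \<Rightarrow> real mat \<Rightarrow> real mat \<Rightarrow> bool" where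
  "isometric_to_listed idx A \<eta> \<longleftrightarrow>
     (\<exists>A' \<eta>'. (listed_1 CARD('n) \<eta>' A' \<or> listed_2 CARD('n) \<eta>' A' \<or> listed_3 CARD('n) \<eta>' A') \<and>
        isometric (metric_of idx A \<eta>) (metric_of idx A' \<eta>'))"

end

(*
Extend A by a zero row and column to an n x n matrix X. Then g(x) = E^T h E with E = exp(- x_n X),
h = eta, and all curvature quantities are obtained by moving bilinear expressions in X and h with E;
hence flatness and Ricci-flatness are algebraic conditions on X at the origin.

If the last coordinate direction tau is not null, let S be the h-self-adjoint part of X. Ricci-flatness
says tr S^2 = 0 and [X, S] = 0, and then X and S define the same metric, namely h exp(- 2 x_n S).
In case (a) S is symmetric, so S = 0 and g is flat. In case (b) S is self-adjoint for a Lorentz form on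
the complement of tau. Splitting off spacelike eigenvectors one finds a nonreal eigenvalue pair, which
gives (1), or a timelike eigenvector, which forces S = 0, or a null eigenvector l. In the last case
tr S^2 = 0 forces S l = 0 and S w in the line of l for w orthogonal to l; then either S has rank at
most one and g is flat, or a suitable frame brings S into the form (2).

In case (c) Ricci-flatness makes nu = h tau an eigenvector of X, say X nu = a nu. If a is nonzero,
rescaling nu and tau gives (3); if a = 0, then Ric(tau, tau) = 0 forces X to be skew modulo nu and tau,
and g is flat.
*)
theory Submission
  imports Defs "HOL-Computational_Algebra.Fundamental_Theorem_Algebra"
begin

text \<open>All three forms satisfy \<open>h ** h = idm\<close>, so raising an index is
  multiplication by \<open>h\<close>, and one locale carries the curvature computation; the cases
  differ only in how \<open>h\<close> acts on the last coordinate vector. Every isometry used is a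
  linear map L that preserves h, satisfies L X = s X' L and multiplies x_n by s. The factor s = -1
  reverses x_n and serves to reach \<alpha> \<le> 0; s = a normalizes the eigenvalue in (3). The
  obstacle in case (b) is that an operator self-adjoint for an indefinite form need not be
  diagonalizable. It is diagonalizable on the orthogonal complement of an invariant subspace that
  contains a timelike vector, so only a small block around such a vector is found by hand, and tr
  S^2 = 0 restricts this block. In case (c) the matrix h M, with M = X^T h + h X, need not
  annihilate tau.\<close>

abbreviation idm :: "real ^ 'n::finite ^ 'n" where
  "idm \<equiv> Finite_Cartesian_Product.mat 1"

abbreviation tp :: "real ^ 'm ^ 'n \<Rightarrow> real ^ 'n ^ 'm" where
  "tp \<equiv> Finite_Cartesian_Product.transpose"

lemmas vec_ext = Finite_Cartesian_Product.vec_eq_iff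

lemma mat_eqI: "(\<And>i j. A $ i $ j = B $ i $ j) \<Longrightarrow> A = (B :: 'a ^ 'm ^ 'n)"
  by (simp add: vec_ext)

lemma scaleR_mm [simp]: "(c *\<^sub>R A) ** B = c *\<^sub>R (A ** (B :: real ^ 'n::finite ^ 'n))"
    "A ** (c *\<^sub>R B) = c *\<^sub>R (A ** (B :: real ^ 'n::finite ^ 'n))"
  by (simp_all add: vec_ext matrix_matrix_mult_def sum_distrib_left mult_ac)

section \<open>The matrix exponential\<close>

primrec mpow :: "real ^ 'n::finite ^ 'n \<Rightarrow> nat \<Rightarrow> real ^ 'n ^ 'n" where
  "mpow X 0 = idm"
| "mpow X (Suc k) = X ** mpow X k"

definition mcoef :: "real ^ 'n::finite ^ 'n \<Rightarrow> nat \<Rightarrow> real ^ 'n ^ 'n" where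
  "mcoef X k = (1 / fact k) *\<^sub>R mpow X k"

text \<open>Each entry is a power series in the scalar t with X fixed, so differentiation in t is
  termwise differentiation of real power series.\<close>

definition mexp :: "real ^ 'n::finite ^ 'n \<Rightarrow> real \<Rightarrow> real ^ 'n ^ 'n" where
  "mexp X t = (\<chi> i j. \<Sum>k. mcoef X k $ i $ j * t ^ k)"

text \<open>The sum of the absolute values of all entries bounds every row sum, hence one more
  factor X costs at most one more factor of it.\<close>

lemma mpow_bound:
  fixes X :: "real ^ 'n::finite ^ 'n"
  shows "\<bar>mpow X k $ i $ j\<bar> \<le> (\<Sum>i\<in>UNIV. \<Sum>j\<in>UNIV. \<bar>X $ i $ j\<bar>) ^ k"
proof (induction k arbitrary: i)
  case 0
  then show ?case by (simp add: Finite_Cartesian_Product.mat_def)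
next
  case (Suc k)
  let ?c = "\<Sum>i\<in>UNIV. \<Sum>j\<in>UNIV. \<bar>X $ i $ j\<bar>"
  have "\<bar>mpow X (Suc k) $ i $ j\<bar> \<le> (\<Sum>m\<in>UNIV. \<bar>X $ i $ m * mpow X k $ m $ j\<bar>)"
    by (simp add: matrix_matrix_mult_def sum_abs)
  also have "\<dots> \<le> (\<Sum>m\<in>UNIV. \<bar>X $ i $ m\<bar> * ?c ^ k)"
    using Suc by (intro sum_mono) (auto simp: abs_mult intro: mult_left_mono)
  also have "\<dots> = (\<Sum>m\<in>UNIV. \<bar>X $ i $ m\<bar>) * ?c ^ k"
    by (simp add: sum_distrib_right)
  also have "\<dots> \<le> ?c * ?c ^ k"
    by (intro mult_right_mono member_le_sum[where f="\<lambda>i. \<Sum>m\<in>UNIV. \<bar>X $ i $ m\<bar>"] zero_le_power)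
      (auto intro!: sum_nonneg)
  finally show ?case by simp
qed

lemma mexp_summable:
  fixes X :: "real ^ 'n::finite ^ 'n"
  shows "summable (\<lambda>k. mcoef X k $ i $ j * t ^ k)"
proof (rule summable_comparison_test')
  let ?c = "\<Sum>i\<in>UNIV. \<Sum>j\<in>UNIV. \<bar>X $ i $ j\<bar>"
  show "summable (\<lambda>k. inverse (fact k) * (?c * \<bar>t\<bar>) ^ k)"
    by (rule summable_exp)
  fix k :: nat
  show "norm (mcoef X k $ i $ j * t ^ k) \<le> inverse (fact k) * (?c * \<bar>t\<bar>) ^ k"
    using mpow_bound[of X k i j]
    by (simp add: mcoef_def abs_mult power_abs power_mult_distrib field_simps mult_left_mono)
qed

lemma mexp_has_derivative:
  fixes X :: "real ^ 'n::finite ^ 'n"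
  shows "((\<lambda>t. mexp X t $ i $ j) has_real_derivative (X ** mexp X t) $ i $ j) (at t)"
proof -
  have "((\<lambda>t. mexp X t $ i $ j) has_real_derivative
      (\<Sum>k. diffs (\<lambda>k. mcoef X k $ i $ j) k * t ^ k)) (at t)"
    unfolding mexp_def vec_lambda_beta
    by (intro termdiffs_strong_converges_everywhere mexp_summable)
  also have "(\<Sum>k. diffs (\<lambda>k. mcoef X k $ i $ j) k * t ^ k) =
      (\<Sum>k. \<Sum>m\<in>UNIV. X $ i $ m * (mcoef X k $ m $ j * t ^ k))"
    by (intro suminf_cong)
      (simp add: diffs_def mcoef_def matrix_matrix_mult_def sum_distrib_right sum_distrib_left field_simps del: of_nat_Suc)
  also have "\<dots> = (\<Sum>m\<in>UNIV. \<Sum>k. X $ i $ m * (mcoef X k $ m $ j * t ^ k))"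
    by (intro suminf_sum summable_mult mexp_summable)
  also have "\<dots> = (X ** mexp X t) $ i $ j"
    by (simp add: matrix_matrix_mult_def mexp_def suminf_mult mexp_summable)
  finally show ?thesis .
qed

lemma mexp_0 [simp]: "mexp X 0 = idm"
  by (rule mat_eqI, unfold mexp_def vec_lambda_beta powser_zero) (simp add: mcoef_def)

text \<open>The k-th powers satisfy the relation with factor s^k, which passing from t to s t
  absorbs. L may be singular: commuting matrices, kernel vectors and isometries are all
  instances.\<close>

lemma mexp_intertwine:
  fixes L X X' :: "real ^ 'n::finite ^ 'n"
  assumes "L ** X = s *\<^sub>R (X' ** L)"
  shows "L ** mexp X t = mexp X' (s * t) ** L"
proof -
  have pow: "L ** mpow X k = s ^ k *\<^sub>R (mpow X' k ** L)" for k
  proof (induction k)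
    case (Suc k)
    have "L ** mpow X (Suc k) = s *\<^sub>R (X' ** (L ** mpow X k))"
      by (simp add: matrix_mul_assoc assms)
    then show ?case
      using Suc by (simp add: matrix_mul_assoc)
  qed simp
  have coef: "L ** mcoef X k = s ^ k *\<^sub>R (mcoef X' k ** L)" for k
    by (simp add: mcoef_def pow)
  show ?thesis
  proof (rule mat_eqI)
    fix i j
    have "(L ** mexp X t) $ i $ j = (\<Sum>m\<in>UNIV. \<Sum>k. L $ i $ m * (mcoef X k $ m $ j * t ^ k))"
      by (simp add: matrix_matrix_mult_def mexp_def suminf_mult mexp_summable)
    also have "\<dots> = (\<Sum>k. \<Sum>m\<in>UNIV. L $ i $ m * (mcoef X k $ m $ j * t ^ k))"
      by (intro suminf_sum[symmetric] summable_mult mexp_summable)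
    also have "\<dots> = (\<Sum>k. (L ** mcoef X k) $ i $ j * t ^ k)"
      by (simp add: matrix_matrix_mult_def sum_distrib_left sum_distrib_right mult_ac)
    also have "\<dots> = (\<Sum>k. \<Sum>m\<in>UNIV. (mcoef X' k $ i $ m * (s * t) ^ k) * L $ m $ j)"
      unfolding coef by (simp add: matrix_matrix_mult_def sum_distrib_right 
          sum_distrib_left mult_ac power_mult_distrib)
    also have "\<dots> = (\<Sum>m\<in>UNIV. \<Sum>k. (mcoef X' k $ i $ m * (s * t) ^ k) * L $ m $ j)"
      by (intro suminf_sum summable_mult2 mexp_summable)
    also have "\<dots> = (mexp X' (s * t) ** L) $ i $ j"
      by (simp add: matrix_matrix_mult_def mexp_def suminf_mult2 mexp_summable)
    finally show "(L ** mexp X t) $ i $ j = (mexp X' (s * t) ** L) $ i $ j" .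
  qed
qed

lemma mexp_commute: "S ** X = X ** S \<Longrightarrow> S ** mexp X t = mexp X t ** S"
  using mexp_intertwine[of S X 1 X t] by simp

lemma mpow_transpose: "mpow (tp X) k = tp (mpow X k)"
proof (induction k)
  case (Suc k)
  have "mpow X k ** X = X ** mpow X k" for X :: "real ^ 'a ^ 'a"
    by (induction k) (simp_all add: matrix_mul_assoc[symmetric])
  with Suc show ?case by (simp add: matrix_transpose_mul flip: matrix_transpose_mul)
qed simp

lemma mexp_transpose: "mexp (tp X) t = tp (mexp X t)"
  by (simp add: mexp_def mcoef_def vec_ext mpow_transpose, simp add: Finite_Cartesian_Product.transpose_def)

section \<open>Derivatives of matrix-valued curves\<close>

definition mderiv :: "(real \<Rightarrow> real ^ 'n::finite ^ 'n) \<Rightarrow> real ^ 'n ^ 'n \<Rightarrow> real \<Rightarrow> bool" where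
  "mderiv F D t \<longleftrightarrow> (\<forall>i j. ((\<lambda>s. F s $ i $ j) has_real_derivative D $ i $ j) (at t))"

lemma mderiv_mult:
  assumes "mderiv F D t" "mderiv G D' t"
  shows "mderiv (\<lambda>s. F s ** G s) (D ** G t + F t ** D') t"
  unfolding mderiv_def
proof (intro allI)
  fix i j
  have "((\<lambda>s. \<Sum>m\<in>UNIV. F s $ i $ m * G s $ m $ j) has_real_derivative
    (\<Sum>m\<in>UNIV. D $ i $ m * G t $ m $ j + D' $ m $ j * F t $ i $ m)) (at t)"
    using assms unfolding mderiv_def by (intro DERIV_sum DERIV_mult) auto
  then show "((\<lambda>s. (F s ** G s) $ i $ j) has_real_derivative (D ** G t + F t ** D') $ i $ j) (at t)"
    by (simp add: matrix_matrix_mult_def sum.distrib mult_ac)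
qed

lemma mderiv_const: "mderiv (\<lambda>s. C) 0 t"
  by (simp add: mderiv_def)

lemma mderiv_transpose: "mderiv F D t \<Longrightarrow> mderiv (\<lambda>s. tp (F s)) (tp D) t"
  by (simp add: mderiv_def Finite_Cartesian_Product.transpose_def)

lemma mderiv_mexp: "mderiv (\<lambda>s. mexp X s) (X ** mexp X t) t"
  by (simp add: mderiv_def mexp_has_derivative)

lemma mderiv_mexp_scaled: "mderiv (\<lambda>s. mexp X (c * s)) (c *\<^sub>R (X ** mexp X (c * t))) t"
  unfolding mderiv_def
proof (intro allI)
  fix i j
  have "((\<lambda>s. mexp X (c * s) $ i $ j) has_real_derivative ((X ** mexp X (c * t)) $ i $ j) * c) (at t)"
    by (rule DERIV_chain'[where f="\<lambda>s. c * s" and g="\<lambda>s. mexp X s $ i $ j", simplified])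
      (auto intro!: derivative_eq_intros mexp_has_derivative)
  then show "((\<lambda>s. mexp X (c * s) $ i $ j) has_real_derivative (c *\<^sub>R (X ** mexp X (c * t))) $ i $ j) (at t)"
    by (simp add: mult_ac)
qed

lemma mderiv_mexp_uminus: "mderiv (\<lambda>s. mexp X (- s)) (- (X ** mexp X (- t))) t"
  using mderiv_mexp_scaled[of X "-1" t] by simp

lemma mderiv_zero_constant:
  assumes "\<And>t. mderiv F 0 t"
  shows "F t = F (0::real)"
proof (rule mat_eqI)
  fix i j
  show "F t $ i $ j = F 0 $ i $ j"
    using assms by (intro DERIV_isconst_all) (auto simp: mderiv_def)
qed

lemma matrix_mult_uminus_left: "(- A) ** B = - (A ** (B :: real ^ 'n::finite ^ 'n))"
  by (simp add: vec_ext matrix_matrix_mult_def sum_negf)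

text \<open>The product has derivative zero, because X commutes with its exponential, and it is the
  identity at 0.\<close>

lemma mexp_inverse: "mexp X (- t) ** mexp X t = idm"
proof -
  have "mderiv (\<lambda>s. mexp X (- s) ** mexp X s) 0 t" for t
    using mderiv_mult[OF mderiv_mexp_uminus[of X t] mderiv_mexp[of X t]]
    by (simp add: matrix_mult_uminus_left matrix_mul_assoc mexp_commute[OF refl, symmetric])
  from mderiv_zero_constant[OF this] show ?thesis by simp
qed

lemma mexp_inverse': "mexp X t ** mexp X (- t) = idm"
  using mexp_inverse[of X "- t"] by simp

section \<open>Curvature of left-invariant metrics\<close>

declare transpose_matrix_vector [simp del]

lemma mv_assoc: "(A ** B) *v x = A *v (B *v (x :: real ^ 'n::finite))"
  by (simp add: matrix_vector_mul_assoc)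

lemma inner_mv: "u \<bullet> (A *v v) = (tp A *v u) \<bullet> (v :: real ^ 'n::finite)"
  by (simp add: dot_lmul_matrix transpose_matrix_vector)

lemma inner_mv': "(A *v u) \<bullet> v = u \<bullet> (tp A *v (v :: real ^ 'n::finite))"
  by (simp add: inner_mv)

lemma mv_scaleR: "A *v (c *\<^sub>R x) = c *\<^sub>R (A *v (x :: real ^ 'n::finite))"
  by (rule matrix_vector_mult_scaleR)

lemma scaleR_mv: "(c *\<^sub>R A) *v x = c *\<^sub>R (A *v (x :: real ^ 'n::finite))"
  by (simp add: scaleR_matrix_vector_assoc)

lemma mv_uminus: "A *v (- x) = - (A *v (x :: real ^ 'n::finite))"
  using mv_scaleR[of A "- 1" x] by simp

lemma uminus_mv: "(- A) *v x = - (A *v (x :: real ^ 'n::finite))"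
  using scaleR_mv[of "- 1" A x] by simp

lemma mv_sum: "A *v (\<Sum>i\<in>S. f i) = (\<Sum>i\<in>S. A *v (f i :: real ^ 'n::finite))"
  by (induction S rule: infinite_finite_induct) (auto simp: algebra_simps)

lemmas mv_simps = mv_assoc mv_scaleR scaleR_mv mv_uminus uminus_mv matrix_vector_right_distrib
  matrix_vector_mult_diff_distrib matrix_vector_mult_add_rdistrib matrix_vector_mult_diff_rdistrib

lemma matrix_entry: "A $ i $ j = axis i 1 \<bullet> (A *v (axis j 1 :: real ^ 'n::finite))"
  by (simp add: matrix_vector_mult_basis column_def inner_axis')

lemma axis_nth: "axis i (1::real) $ j = (if j = i then 1 else 0)"
  by (simp add: axis_def)

lemma vec_expansion: "(\<Sum>i\<in>UNIV. x $ i *\<^sub>R axis i 1) = (x :: real ^ 'n::finite)"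
  using basis_expansion[of x] by (simp add: scalar_mult_eq_scaleR)

section \<open>Derivatives of vector-valued curves and along one coordinate\<close>

lemma has_vector_derivative_vec:
  fixes f :: "real \<Rightarrow> 'a::euclidean_space ^ 'n::finite"
  assumes "\<And>i. ((\<lambda>t. f t $ i) has_vector_derivative D $ i) (at t)"
  shows "(f has_vector_derivative D) (at t)"
proof -
  have "((\<lambda>t. f t $ i \<bullet> b) has_derivative (\<lambda>x. (x *\<^sub>R D $ i) \<bullet> b)) (at t)" for i b
    using assms[of i] unfolding has_vector_derivative_def by (rule has_derivative_inner_left)
  then show ?thesis
    unfolding has_vector_derivative_def has_derivative_componentwise_within[of f]
    by (auto simp: Basis_vec_def inner_axis)
qed

lemma mderiv_iff_has_vector_derivative:
  "mderiv F D t \<longleftrightarrow> (F has_vector_derivative D) (at t)"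
proof
  assume "mderiv F D t"
  then show "(F has_vector_derivative D) (at t)"
    by (intro has_vector_derivative_vec)
      (simp add: mderiv_def flip: has_real_derivative_iff_has_vector_derivative)
next
  assume *: "(F has_vector_derivative D) (at t)"
  show "mderiv F D t"
    unfolding mderiv_def has_real_derivative_iff_has_vector_derivative
    by (intro allI bounded_linear.has_vector_derivative[OF bounded_linear_vec_nth] *)
qed

lemma bounded_bilinear_mv: "bounded_bilinear ((*v) :: real ^ 'n::finite ^ 'n \<Rightarrow> _)"
  by (rule bilinear_conv_bounded_bilinear[THEN iffD1], unfold bilinear_def)
    (intro allI conjI linearI; simp add: mv_simps)

text \<open>The metric depends on x_T alone, so every partial derivative in the curvature formulas
  reduces to an ordinary one.\<close>

lemma partial_coordinate:
  assumes "(f has_real_derivative D) (at (x $ T))"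
  shows "partial i (\<lambda>y. f (y $ T)) x = (if i = T then D else 0)"
proof -
  have "((\<lambda>y. y $ T) has_derivative (\<lambda>v. v $ T)) (at x)"
    by (rule bounded_linear_imp_has_derivative[OF bounded_linear_vec_nth])
  moreover have "(f has_derivative (*) D) (at (x $ T))"
    using assms unfolding has_field_derivative_def .
  ultimately have "((\<lambda>y. f (y $ T)) has_derivative (\<lambda>v. D * (v $ T))) (at x)"
    by (rule has_derivative_compose)
  from frechet_derivative_at[OF this, symmetric] show ?thesis
    by (simp add: partial_def axis_def)
qed

lemma matrix_inv_eqI:
  fixes A B :: "real ^ 'n::finite ^ 'n"
  assumes "B ** A = idm" "A ** B = idm"
  shows "matrix_inv A = B"
proof -
  have "A ** matrix_inv A = idm"
    unfolding matrix_inv_def using assms by (metis (mono_tags, lifting) someI_ex)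
  then have "(B ** A) ** matrix_inv A = B"
    by (simp add: matrix_mul_assoc[symmetric])
  then show ?thesis by (simp add: assms)
qed

text \<open>This is \<open>metric_of\<close> with A extended by zeros to X: row and column T of the
  exponential are then those of the identity, which is what \<open>expand\<close> adds.\<close>

definition gmet :: "'n::finite \<Rightarrow> real ^ 'n ^ 'n \<Rightarrow> real ^ 'n ^ 'n \<Rightarrow> 'n metric" where
  "gmet T h X x = tp (mexp X (- (x $ T))) ** h ** mexp X (- (x $ T))"

lemma tp_uminus: "tp (- A) = - tp (A :: real ^ 'm ^ 'n)"
  by (simp add: Finite_Cartesian_Product.transpose_def vec_ext)

lemma tp_add: "tp (A + B) = tp A + tp (B :: real ^ 'm ^ 'n)"
  by (simp add: Finite_Cartesian_Product.transpose_def vec_ext)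

text \<open>\<open>X_tau\<close> and \<open>X_T\<close> say that column and row T of X vanish. Since
  \<open>h\<close> is its own inverse, it serves both as the form and as the inverse form.\<close>

locale left_invariant =
  fixes X h :: "real ^ 'n::finite ^ 'n" and T :: 'n
  assumes h_sym: "tp h = h" and h_inv: "h ** h = idm"
    and X_tau: "X *v axis T 1 = 0" and X_T: "\<And>v. (X *v v) $ T = 0"
begin

abbreviation tau :: "real ^ 'n" where "tau \<equiv> axis T 1"

text \<open>Minus the derivative of the Gram matrix at parameter 0; its product with
  \<open>h\<close> is twice the self-adjoint part of X.\<close>

definition M where "M = tp X ** h + h ** X"

abbreviation E where "E t \<equiv> mexp X (- t)"

text \<open>In the frame moved by \<open>E\<close>, \<open>Theta\<close> is the tensor of Christoffel symbols, \<open>Lam\<close> its derivative in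
  the direction \<open>tau\<close> and \<open>Rm U V W\<close> the curvature \<open>R(U, V) W\<close>.\<close>

definition Theta :: "real ^ 'n \<Rightarrow> real ^ 'n \<Rightarrow> real ^ 'n" where
  "Theta u v = - (1/2) *\<^sub>R (h *v (u $ T *\<^sub>R (M *v v) + v $ T *\<^sub>R (M *v u) - (u \<bullet> (M *v v)) *\<^sub>R tau))"

definition Lam :: "real ^ 'n \<Rightarrow> real ^ 'n \<Rightarrow> real ^ 'n" where
  "Lam u v = X *v Theta u v - Theta (X *v u) v - Theta u (X *v v)"

definition Rm :: "real ^ 'n \<Rightarrow> real ^ 'n \<Rightarrow> real ^ 'n \<Rightarrow> real ^ 'n" where
  "Rm U V W = U $ T *\<^sub>R Lam V W - V $ T *\<^sub>R Lam U W + Theta U (Theta V W) - Theta V (Theta U W)"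

lemma hh [simp]: "h *v (h *v v) = v"
  using h_inv by (metis mv_assoc matrix_vector_mul_lid)

lemma h_selfadjoint: "u \<bullet> (h *v v) = (h *v u) \<bullet> v"
  by (simp add: inner_mv h_sym)

lemma M_sym: "tp M = M"
  by (simp add: M_def tp_add matrix_transpose_mul h_sym add.commute)

lemma M_selfadjoint: "u \<bullet> (M *v v) = (M *v u) \<bullet> v"
  by (simp add: inner_mv M_sym)

lemma bilinear_Theta: "bilinear Theta"
  unfolding bilinear_def Theta_def
  by (auto intro!: linearI simp: mv_simps algebra_simps inner_add_left M_selfadjoint add_divide_distrib)

lemmas Theta_linear = bilinear_ladd[OF bilinear_Theta] bilinear_radd[OF bilinear_Theta]
  bilinear_lmul[OF bilinear_Theta] bilinear_rmul[OF bilinear_Theta]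
  bilinear_lneg[OF bilinear_Theta] bilinear_rneg[OF bilinear_Theta]
  bilinear_lsub[OF bilinear_Theta] bilinear_rsub[OF bilinear_Theta]
  bilinear_lzero[OF bilinear_Theta] bilinear_rzero[OF bilinear_Theta]

lemma bilinear_Lam: "bilinear Lam"
  unfolding bilinear_def Lam_def
  by (auto intro!: linearI simp: mv_simps Theta_linear algebra_simps)

lemma mexp_zero: "mexp 0 t = idm"
  using mexp_intertwine[of idm 0 0 0 t] by simp

lemma mexp_kernel:
  fixes Y :: "real ^ 'n ^ 'n"
  assumes "Y *v v = 0"
  shows "mexp Y t *v v = v"
proof -
  \<comment> \<open>All columns are v, so this matrix intertwines the zero matrix with Y.\<close>
  let ?L = "(\<chi> i j. v $ i) :: real ^ 'n ^ 'n"
  have L: "?L *v tau = v"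
    by (simp add: vec_ext matrix_vector_mult_basis column_def)
  have "Y ** ?L = 0"
    using assms by (simp add: vec_ext matrix_matrix_mult_def matrix_vector_mult_def)
  then have "?L ** mexp 0 t = mexp Y t ** ?L"
    using mexp_intertwine[of ?L 0 1 Y t] by simp
  then have "mexp Y t *v (?L *v tau) = ?L *v (mexp 0 t *v tau)"
    by (metis mv_assoc)
  then show ?thesis by (simp add: L mexp_zero)
qed

lemma tX_tau: "tp X *v tau = 0"
proof -
  have "v \<bullet> (tp X *v tau) = 0" for v
    using X_T[of v] by (simp add: inner_axis flip: inner_mv')
  then show ?thesis by (metis inner_eq_zero_iff)
qed

lemma E_tau [simp]: "mexp X t *v tau = tau"
  by (rule mexp_kernel[OF X_tau])

lemma tE_tau [simp]: "tp (mexp X t) *v tau = tau"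
  using mexp_kernel[OF tX_tau] by (simp add: mexp_transpose)

lemma E_T [simp]: "(mexp X t *v v) $ T = v $ T"
  using inner_mv'[of "mexp X t" v tau] by (simp add: inner_axis)

lemma E_Ei [simp]: "E t *v (mexp X t *v v) = v" "mexp X t *v (E t *v v) = v"
  by (simp_all add: matrix_vector_mul_assoc mexp_inverse mexp_inverse')

section \<open>Christoffel symbols and curvature in the frame moved by \<open>E\<close>\<close>

lemma mderiv_gmet: "mderiv (\<lambda>t. tp (E t) ** h ** E t) (- (tp (E t) ** M ** E t)) t"
proof -
  have "mderiv (\<lambda>t. tp (E t) ** h ** E t)
    ((tp (- (X ** E t)) ** h + tp (E t) ** 0) ** E t + tp (E t) ** h ** (- (X ** E t))) t"
    by (intro mderiv_mult mderiv_transpose mderiv_mexp_uminus mderiv_const)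
  moreover have "(tp (- (X ** E t)) ** h + tp (E t) ** 0) ** E t + tp (E t) ** h ** (- (X ** E t))
      = - (tp (E t) ** M ** E t)"
    by (rule mat_eqI)
      (simp add: matrix_entry mv_simps inner_mv' M_def inner_diff_right inner_add_right
        inner_minus_right matrix_transpose_mul tp_uminus)
  ultimately show ?thesis by simp
qed

lemma matrix_inv_gmet:
  "matrix_inv (tp (E t) ** h ** E t) = mexp X t ** h ** tp (mexp X t)"
proof (rule matrix_inv_eqI)
  have t: "tp (mexp X t) *v (tp (E t) *v v) = v" "tp (E t) *v (tp (mexp X t) *v v) = v" for v
    using mexp_inverse[of X t] mexp_inverse'[of X t]
    by (simp_all add: matrix_vector_mul_assoc flip: matrix_transpose_mul)
  show "mexp X t ** h ** tp (mexp X t) ** (tp (E t) ** h ** E t) = idm"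
    unfolding matrix_eq by (simp add: mv_assoc t)
  show "tp (E t) ** h ** E t ** (mexp X t ** h ** tp (mexp X t)) = idm"
    unfolding matrix_eq by (simp add: mv_assoc t)
qed


lemma tEi_tE [simp]: "tp (mexp X t) *v (tp (E t) *v v) = v"
  using mexp_inverse[of X t] by (simp add: matrix_vector_mul_assoc flip: matrix_transpose_mul)

lemma partial_gmet:
  "partial i (\<lambda>y. gmet T h X y $ j $ l) x =
    - (axis i 1 $ T * (tp (E (x $ T)) ** M ** E (x $ T)) $ j $ l)"
proof -
  have "partial i (\<lambda>y. gmet T h X y $ j $ l) x =
    (if i = T then (- (tp (E (x $ T)) ** M ** E (x $ T))) $ j $ l else 0)"
    unfolding gmet_def
    by (rule partial_coordinate[where f="\<lambda>t. (tp (E t) ** h ** E t) $ j $ l"])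
      (rule mderiv_gmet[unfolded mderiv_def, rule_format])
  then show ?thesis by (simp add: axis_def)
qed

text \<open>The symbols with all indices lowered form the covector w, which is the transpose of
  \<open>E\<close> applied to a covector in the moving frame; the inverse metric cancels that
  transpose.\<close>

lemma christoffel_gmet:
  "christoffel (gmet T h X) k i j x =
    (mexp X (x $ T) *v Theta (E (x $ T) *v axis i 1) (E (x $ T) *v axis j 1)) $ k"
proof -
  let ?t = "x $ T"
  define N where "N = tp (E ?t) ** M ** E ?t"
  define d where "d i = (axis i 1 :: real ^ 'n) $ T" for i
  define w where "w = - (1/2) *\<^sub>R (d i *\<^sub>R (N *v axis j 1) + d j *\<^sub>R (N *v axis i 1) - (N $ i $ j) *\<^sub>R tau)"
  have N_entry: "N $ a $ b = (E ?t *v axis a 1) \<bullet> (M *v (E ?t *v axis b 1))" for a b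
    by (simp add: matrix_entry N_def mv_assoc inner_mv')
  have N_sym: "N $ a $ b = N $ b $ a" for a b
    unfolding N_entry by (subst M_selfadjoint) (rule inner_commute)
  have w_nth: "w $ l = (1/2) * (- (d i * N $ j $ l) + - (d j * N $ i $ l) - - (d l * N $ i $ j))" for l
  proof -
    have "tau $ l = d l" by (simp add: d_def axis_def)
    then show ?thesis
      unfolding w_def by (simp add: matrix_vector_mult_basis column_def N_sym[of l i] N_sym[of l j])
        (simp add: field_simps)
  qed
  have "christoffel (gmet T h X) k i j x =
    (1/2) * (\<Sum>l\<in>UNIV. matrix_inv (gmet T h X x) $ k $ l * (- (d i * N $ j $ l) + - (d j * N $ i $ l) - - (d l * N $ i $ j)))"
    unfolding christoffel_def partial_gmet N_def d_def ..
  also have "\<dots> = (matrix_inv (gmet T h X x) *v w) $ k"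
    by (simp add: matrix_vector_mult_def sum_distrib_left w_nth mult_ac)
  also have "matrix_inv (gmet T h X x) *v w = mexp X ?t *v (h *v (tp (mexp X ?t) *v w))"
    by (simp add: gmet_def matrix_inv_gmet mv_assoc)
  also have "w = tp (E ?t) *v (- (1/2) *\<^sub>R (d i *\<^sub>R (M *v (E ?t *v axis j 1)) + d j *\<^sub>R (M *v (E ?t *v axis i 1)) - (N $ i $ j) *\<^sub>R tau))"
    by (simp add: w_def N_def mv_simps)
  also have "N $ i $ j = (E ?t *v axis i 1) \<bullet> (M *v (E ?t *v axis j 1))"
    by (rule N_entry)
  finally show ?thesis
    by (simp add: Theta_def d_def mv_scaleR mv_uminus)
qed

text \<open>By the product rule the outer exponential contributes X and each argument contributes
  -X. \<open>Lam\<close> is this infinitesimal action on \<open>Theta\<close>; X commutes with the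
  exponential.\<close>

lemma Theta_curve_derivative:
  "((\<lambda>t. mexp X t *v Theta (E t *v u) (E t *v v)) has_vector_derivative
    mexp X t *v Lam (E t *v u) (E t *v v)) (at t)"
proof -
  have E: "((\<lambda>t. E t *v u) has_vector_derivative - (X *v (E t *v u))) (at t)" for u
    using bounded_bilinear.has_vector_derivative[OF bounded_bilinear_mv
        mderiv_mexp_uminus[of X t, unfolded mderiv_iff_has_vector_derivative]
        has_vector_derivative_const[of u]]
    by (simp add: mv_simps)
  have Th: "((\<lambda>t. Theta (E t *v u) (E t *v v)) has_vector_derivative
     Theta (E t *v u) (- (X *v (E t *v v))) + Theta (- (X *v (E t *v u))) (E t *v v)) (at t)"
    by (rule bounded_bilinear.has_vector_derivative[OF bilinear_Theta[unfolded bilinear_conv_bounded_bilinear] E E])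
  have comm: "X *v (mexp X t *v w) = mexp X t *v (X *v w)" for w
    by (metis mexp_commute mv_assoc)
  show ?thesis
    using bounded_bilinear.has_vector_derivative[OF bounded_bilinear_mv
        mderiv_mexp[of X t, unfolded mderiv_iff_has_vector_derivative] Th]
    by (simp add: mv_simps Lam_def Theta_linear comm algebra_simps)
qed

lemma partial_christoffel_gmet:
  "partial m (christoffel (gmet T h X) k i j) x =
    axis m 1 $ T * (mexp X (x $ T) *v Lam (E (x $ T) *v axis i 1) (E (x $ T) *v axis j 1)) $ k"
proof -
  have "((\<lambda>t. (mexp X t *v Theta (E t *v axis i 1) (E t *v axis j 1)) $ k) has_real_derivative
    (mexp X (x $ T) *v Lam (E (x $ T) *v axis i 1) (E (x $ T) *v axis j 1)) $ k) (at (x $ T))"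
    unfolding has_real_derivative_iff_has_vector_derivative
    by (rule bounded_linear.has_vector_derivative[OF bounded_linear_vec_nth Theta_curve_derivative])
  from partial_coordinate[OF this, of m] show ?thesis
    by (simp add: christoffel_gmet[abs_def] axis_def)
qed

text \<open>Contracting over m composes the two tensors: the exponential in front of the inner one
  cancels the \<open>E\<close> in the argument of the outer one.\<close>

lemma christoffel_product:
  "(\<Sum>m\<in>UNIV. christoffel (gmet T h X) l i m x * christoffel (gmet T h X) m j k x) =
    (mexp X (x $ T) *v Theta (E (x $ T) *v axis i 1)
      (Theta (E (x $ T) *v axis j 1) (E (x $ T) *v axis k 1))) $ l"
proof -
  let ?t = "x $ T" and ?u = "E (x $ T) *v axis i 1"
  define w where "w = mexp X ?t *v Theta (E ?t *v axis j 1) (E ?t *v axis k 1)"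
  have "E ?t *v w = (\<Sum>m\<in>UNIV. w $ m *\<^sub>R (E ?t *v axis m 1))"
    by (subst vec_expansion[of w, symmetric]) (simp add: mv_sum mv_scaleR)
  then have "mexp X ?t *v Theta ?u (E ?t *v w) =
    (\<Sum>m\<in>UNIV. w $ m *\<^sub>R (mexp X ?t *v Theta ?u (E ?t *v axis m 1)))"
    using linear_sum[of "Theta ?u" "\<lambda>m. w $ m *\<^sub>R (E ?t *v axis m 1)" UNIV] bilinear_Theta
    by (simp add: bilinear_def mv_sum Theta_linear mv_scaleR)
  then show ?thesis
    by (simp add: christoffel_gmet w_def mult.commute)
qed

lemma riemann_gmet:
  "riemann (gmet T h X) l k i j x =
    (mexp X (x $ T) *v Rm (E (x $ T) *v axis i 1) (E (x $ T) *v axis j 1) (E (x $ T) *v axis k 1)) $ l"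
  unfolding riemann_def sum_subtractf christoffel_product partial_christoffel_gmet
  by (simp add: Rm_def mv_simps)

lemma flat_gmetI: "(\<And>U V W. Rm U V W = 0) \<Longrightarrow> flat (gmet T h X)"
  by (simp add: flat_def riemann_gmet)

section \<open>The Ricci form at the origin\<close>

definition Ric :: "real ^ 'n \<Rightarrow> real ^ 'n \<Rightarrow> real" where
  "Ric V W = (\<Sum>i\<in>UNIV. Rm (axis i 1) V W $ i)"

lemma bilinear_Ric: "bilinear Ric"
  unfolding bilinear_def Ric_def Rm_def
  by (intro conjI allI linearI;
      simp add: Theta_linear bilinear_ladd[OF bilinear_Lam] bilinear_radd[OF bilinear_Lam]
      bilinear_lmul[OF bilinear_Lam] bilinear_rmul[OF bilinear_Lam] algebra_simps
      sum.distrib sum_subtractf sum_distrib_left)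

lemma Ric_eq_0:
  assumes "ricci_flat (gmet T h X)"
  shows "Ric V W = 0"
proof -
  have "Ric (axis j 1) (axis k 1) = 0" for j k
  proof -
    \<comment> \<open>At the origin the exponentials are the identity, and \<open>ricci\<close> is
      \<open>Ric\<close> on basis vectors.\<close>
    have "ricci (gmet T h X) k j 0 = 0"
      using assms by (simp add: ricci_flat_def)
    then show ?thesis by (simp add: ricci_def riemann_gmet Ric_def)
  qed
  moreover have "Ric V W = (\<Sum>j\<in>UNIV. \<Sum>k\<in>UNIV. (V $ j * W $ k) * Ric (axis j 1) (axis k 1))"
  proof -
    have "Ric V W = Ric (\<Sum>j\<in>UNIV. V $ j *\<^sub>R axis j 1) (\<Sum>k\<in>UNIV. W $ k *\<^sub>R axis k 1)"
      by (simp add: vec_expansion)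
    also have "\<dots> = (\<Sum>j\<in>UNIV. \<Sum>k\<in>UNIV. (V $ j * W $ k) * Ric (axis j 1) (axis k 1))"
      by (subst bilinear_sum[OF bilinear_Ric])
        (simp add: bilinear_lmul[OF bilinear_Ric] bilinear_rmul[OF bilinear_Ric] sum.cartesian_product split_def mult_ac)
    finally show ?thesis .
  qed
  ultimately show ?thesis by simp
qed

end

section \<open>Linear isometries\<close>

lemma C_diff_const: "C_diff k (\<lambda>x. c)"
  by (induction k arbitrary: c) auto

lemma smooth_bounded_linear:
  assumes "bounded_linear f"
  shows "smooth f"
proof -
  have "frechet_derivative f (at x) = f" for x
    by (rule frechet_derivative_at[OF bounded_linear_imp_has_derivative[OF assms], symmetric])
  moreover have "f differentiable at x" for x
    by (rule bounded_linear_imp_differentiable[OF assms])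
  moreover have "continuous_on UNIV f"
    by (rule linear_continuous_on[OF assms])
  ultimately have "C_diff k f" for k
    by (cases k) (auto intro: C_diff_const)
  then show ?thesis by (simp add: smooth_def)
qed

text \<open>The isometry is L itself. It scales the T coordinate by s, so the exponential of X' at
  the image point composed with L equals L composed with the exponential of X; what remains is that
  L preserves h.\<close>

lemma isometric_gmet:
  assumes h: "h ** h = idm" and L: "tp L ** h ** L = h"
    and X: "L ** X = s *\<^sub>R (X' ** L)" and T: "\<And>x. (L *v x) $ T = s * x $ T"
  shows "isometric (gmet T h X) (gmet T h X')"
proof -
  \<comment> \<open>The inverse of a map preserving h is its h-adjoint.\<close>
  define K where "K = h ** tp L ** h"
  have KL: "K ** L = idm"
    using L by (simp add: K_def matrix_mul_assoc[symmetric] h)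
  then have LK: "L ** K = idm"
    using matrix_left_right_inverse by blast
  have inv: "K *v (L *v x) = x" "L *v (K *v x) = x" for x
    by (simp_all add: matrix_vector_mul_assoc KL LK)
  have "diffeomorphism ((*v) L)"
    unfolding diffeomorphism_def
  proof (intro conjI)
    show "bij ((*v) L)"
      by (rule o_bij[of "(*v) K"]) (auto simp: fun_eq_iff inv)
    have "inv_into UNIV ((*v) L) = (*v) K"
      by (rule inv_equality) (auto simp: inv)
    then show "smooth (inv_into UNIV ((*v) L))"
      by (simp add: smooth_bounded_linear)
  qed (simp add: smooth_bounded_linear)
  moreover have "pullback ((*v) L) (gmet T h X') x = gmet T h X x" for x
  proof -
    have "frechet_derivative ((*v) L) (at x) = (*v) L"
      by (rule frechet_derivative_at[OF bounded_linear_imp_has_derivative, symmetric]) simp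
    moreover have "mexp X' (- (s * x $ T)) ** L = L ** mexp X (- (x $ T))"
      using mexp_intertwine[OF X, of "- (x $ T)"] by simp
    then have *: "mexp X' (- (s * x $ T)) *v (L *v v) = L *v (mexp X (- (x $ T)) *v v)" for v
      by (metis mv_assoc)
    have **: "(L *v v) \<bullet> (h *v (L *v w)) = v \<bullet> (h *v w)" for v w
      using L by (metis inner_mv' mv_assoc)
    ultimately show ?thesis
      by (intro mat_eqI) (simp add: pullback_def gmet_def T matrix_entry mv_assoc * ** flip: inner_mv')
  qed
  ultimately show ?thesis
    unfolding isometric_def by (intro exI[of _ "(*v) L"]) auto
qed

lemma inner_all_zero: "(\<And>u. u \<bullet> w = 0) \<Longrightarrow> w = (0 :: 'a::real_inner)"
  using inner_eq_zero_iff[of w] by blast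

section \<open>Ricci curvature when the last coordinate direction is not null\<close>

text \<open>The Ricci form is the trace of an endomorphism whose summands either have rank one,
  sending U to U_T v or to (U . w) v, or are plain matrices. This rule and the next two give the
  three traces.\<close>

lemma sum_axis_nth: "(\<Sum>i\<in>UNIV. axis i (1::real) $ T * v $ i) = v $ T"
  by (simp add: axis_def if_distrib[of "\<lambda>x. x * _"] cong: if_cong)

lemma sum_inner_axis: "(\<Sum>i\<in>UNIV. (axis i (1::real) \<bullet> w) * v $ i) = v \<bullet> w"
  unfolding inner_axis' by (simp add: inner_vec_def mult.commute)

lemma sum_mv_axis: "(\<Sum>i\<in>UNIV. (A *v axis i (1::real)) $ i) = trace A"
  by (simp add: trace_def matrix_vector_mult_basis column_def)

lemmas trace_sums = sum_axis_nth sum_inner_axis sum_mv_axis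

text \<open>\<open>eps\<close> is the square of tau: -1 for the matrix (a), 1 for the matrix
  (b).\<close>

locale nonnull = left_invariant +
  fixes eps :: real
  assumes h_tau: "h *v tau = eps *\<^sub>R tau"
begin

text \<open>Equals (X + h X^T h)/2. Up to sign it is the shape operator, in the moving frame, of the
  hypersurfaces on which x_T is constant; compare \<open>Theta_S\<close>.\<close>

definition S where "S = (1/2) *\<^sub>R (h ** M)"

lemma eps_sq: "eps * eps = 1"
proof -
  have "tau = (eps * eps) *\<^sub>R tau"
    using hh[of tau] by (simp add: h_tau mv_scaleR)
  from arg_cong[OF this, of "\<lambda>v. v $ T"] show ?thesis by (simp add: axis_nth)
qed

lemma M_tau: "M *v tau = 0"
  by (simp add: M_def mv_simps h_tau X_tau tX_tau)

lemma S_tau [simp]: "S *v tau = 0"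
  by (simp add: S_def mv_simps M_tau)

lemma S_T [simp]: "(S *v v) $ T = 0"
proof -
  have "(S *v v) \<bullet> tau = (1/2) * ((M *v v) \<bullet> (h *v tau))"
    by (simp add: S_def mv_simps h_selfadjoint)
  also have "\<dots> = 0"
    by (simp add: h_tau M_tau flip: M_selfadjoint)
  finally show ?thesis by (simp add: inner_axis)
qed

lemma M_S: "M *v v = 2 *\<^sub>R (h *v (S *v v))"
  by (simp add: S_def mv_simps)

lemma S_selfadjoint: "(S *v u) \<bullet> (h *v v) = u \<bullet> (h *v (S *v v))"
proof -
  have "2 * ((S *v u) \<bullet> (h *v v)) = (M *v u) \<bullet> v"
    by (simp add: M_S h_selfadjoint)
  also have "\<dots> = 2 * (u \<bullet> (h *v (S *v v)))"
    by (subst M_selfadjoint[symmetric]) (simp add: M_S)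
  finally show ?thesis by simp
qed

lemma X_adjoint: "(X *v u) \<bullet> (h *v v) = 2 * (u \<bullet> (h *v (S *v v))) - u \<bullet> (h *v (X *v v))"
proof -
  have "u \<bullet> (M *v v) = (X *v u) \<bullet> (h *v v) + u \<bullet> (h *v (X *v v))"
    by (simp add: M_def mv_simps inner_add_right inner_mv')
  then show ?thesis by (simp add: M_S)
qed

lemma tau_h [simp]: "tau \<bullet> (h *v v) = eps * v $ T"
  by (simp add: h_selfadjoint h_tau inner_axis')

lemma Theta_S:
  "Theta u v = - (u $ T *\<^sub>R (S *v v)) - v $ T *\<^sub>R (S *v u) + (eps * (u \<bullet> (h *v (S *v v)))) *\<^sub>R tau"
  by (simp add: Theta_def M_S mv_simps h_tau algebra_simps)

lemma Rm_tau_tau: "Rm U tau tau = X *v (S *v U) - S *v (X *v U) - S *v (S *v U)"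
  by (simp add: Rm_def Lam_def Theta_S mv_simps X_tau X_T axis_nth)

text \<open>By \<open>Rm_tau_tau\<close> this is the trace of [X, S] - S^2, and commutators have
  trace zero.\<close>

lemma Ric_tau_tau: "Ric tau tau = - trace (S ** S)"
  unfolding Ric_def Rm_tau_tau
  by (simp add: sum.distrib sum_subtractf sum_negf trace_mul_sym[of X S] flip: mv_assoc)
    (simp add: trace_sums trace_mul_sym[of X S])

text \<open>For U with zero T coordinate only the last two terms remain; they are the Gauss equation
  of a flat hypersurface with shape operator S.\<close>

lemma Rm_horizontal:
  assumes "Y $ T = 0" "Z $ T = 0"
  shows "Rm U Y Z = (eps * U $ T) *\<^sub>R ((Y \<bullet> (h *v (S *v (S *v Z))) - (X *v Y) \<bullet> (h *v (S *v Z))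
      - Y \<bullet> (h *v (S *v (X *v Z)))) *\<^sub>R tau)
    - (eps * (Y \<bullet> (h *v (S *v Z)))) *\<^sub>R (S *v U) + (eps * (U \<bullet> (h *v (S *v Z)))) *\<^sub>R (S *v Y)"
  by (simp add: Rm_def Lam_def Theta_S mv_simps X_tau X_T axis_nth assms algebra_simps)

text \<open>\<open>X_adjoint\<close> moves X from Y to the other argument; the multiples of S^2 then
  cancel, and [X, S] - tr(S) S is left.\<close>

lemma Ric_horizontal:
  assumes "Y $ T = 0" "Z $ T = 0"
  shows "Ric Y Z = eps * (Y \<bullet> (h *v (X *v (S *v Z) - S *v (X *v Z) - trace S *\<^sub>R (S *v Z))))"
proof -
  define c where "c = Y \<bullet> (h *v (S *v (S *v Z))) - (X *v Y) \<bullet> (h *v (S *v Z)) - Y \<bullet> (h *v (S *v (X *v Z)))"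
  have "Ric Y Z = (\<Sum>i\<in>UNIV. eps * c * (axis i 1 $ T * tau $ i) - eps * (Y \<bullet> (h *v (S *v Z))) * (S *v axis i 1) $ i
      + eps * ((axis i 1 \<bullet> (h *v (S *v Z))) * (S *v Y) $ i))"
    unfolding Ric_def Rm_horizontal[OF assms] c_def[symmetric] by (simp add: mult_ac)
  also have "\<dots> = eps * c - eps * (Y \<bullet> (h *v (S *v Z))) * trace S + eps * ((S *v Y) \<bullet> (h *v (S *v Z)))"
    unfolding sum.distrib sum_subtractf sum_distrib_left[symmetric] trace_sums by (simp add: axis_nth)
  also have "\<dots> = eps * (Y \<bullet> (h *v (X *v (S *v Z) - S *v (X *v Z) - trace S *\<^sub>R (S *v Z))))"
    by (simp add: c_def S_selfadjoint X_adjoint mv_simps inner_diff_right algebra_simps)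
  finally show ?thesis .
qed

text \<open>Horizontal vectors yield [X, S] = tr(S) S. Taking traces gives tr(S)^2 = 0, so the
  commutator vanishes too.\<close>

lemma ricci_flat_S:
  assumes "ricci_flat (gmet T h X)"
  shows "trace (S ** S) = 0" and "X ** S = S ** X"
proof -
  show "trace (S ** S) = 0"
    using Ric_eq_0[OF assms, of tau tau] by (simp add: Ric_tau_tau)
  define D where "D = X ** S - S ** X - trace S *\<^sub>R S"
  have D: "D *v v = X *v (S *v v) - S *v (X *v v) - trace S *\<^sub>R (S *v v)" for v
    by (simp add: D_def mv_simps)
  have hor: "D *v Z = 0" if "Z $ T = 0" for Z
  proof -
    have "Y \<bullet> (h *v (D *v Z)) = 0" for Y
    proof -
      define Y' where "Y' = Y - Y $ T *\<^sub>R tau"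
      have "Ric Y' Z = eps * (Y' \<bullet> (h *v (D *v Z)))"
        unfolding D by (rule Ric_horizontal) (simp_all add: Y'_def axis_nth that)
      then have "Y' \<bullet> (h *v (D *v Z)) = 0"
        using Ric_eq_0[OF assms, of Y' Z] eps_sq by auto
      moreover have "tau \<bullet> (h *v (D *v Z)) = 0"
        by (simp add: h_selfadjoint h_tau inner_axis' D X_T)
      ultimately show ?thesis
        by (simp add: Y'_def inner_diff_left)
    qed
    then have "h *v (D *v Z) = 0" by (rule inner_all_zero)
    then have "h *v (h *v (D *v Z)) = 0" by simp
    then show ?thesis by simp
  qed
  have "D *v v = 0" for v
  proof -
    have "D *v (v - v $ T *\<^sub>R tau) = 0" by (rule hor) (simp add: axis_nth)
    moreover have "D *v tau = 0" by (simp add: D X_tau)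
    ultimately show ?thesis by (simp add: mv_simps)
  qed
  then have "D = 0" by (simp add: matrix_eq)
  then have comm: "X ** S - S ** X = trace S *\<^sub>R S" by (simp add: D_def)
  have "trace (X ** S - S ** X) = 0"
    by (simp add: trace_sub trace_mul_sym[of X S])
  then have "trace S = 0"
    by (simp add: comm trace_def sum_distrib_left[symmetric])
  with comm show "X ** S = S ** X" by simp
qed

lemma flat_if_S_zero: "S = 0 \<Longrightarrow> flat (gmet T h X)"
  by (rule flat_gmetI) (simp add: Rm_def Lam_def Theta_S)

text \<open>The product of the Gram matrix with exp(2 t S) is constant: its derivative vanishes
  because M = 2 h S and S commutes with \<open>E\<close>.\<close>

lemma gmet_eq_mexp_S:
  assumes "X ** S = S ** X"
  shows "gmet T h X x = h ** mexp S (- 2 * x $ T)"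
proof -
  let ?G = "\<lambda>t. tp (E t) ** h ** E t"
  have SE: "S *v (E t *v v) = E t *v (S *v v)" for t v
    by (metis mexp_commute assms mv_assoc)
  have "mderiv (\<lambda>t. ?G t ** mexp S (2 * t)) 0 t" for t
  proof -
    have "mderiv (\<lambda>t. ?G t ** mexp S (2 * t)) (- (tp (E t) ** M ** E t) ** mexp S (2 * t)
      + ?G t ** (2 *\<^sub>R (S ** mexp S (2 * t)))) t"
      by (intro mderiv_mult[OF mderiv_gmet] mderiv_mexp_scaled)
    moreover have "- (tp (E t) ** M ** E t) ** mexp S (2 * t) + ?G t ** (2 *\<^sub>R (S ** mexp S (2 * t))) = 0"
      unfolding matrix_eq by (simp add: mv_simps M_S SE)
    ultimately show ?thesis by simp
  qed
  from mderiv_zero_constant[OF this, of "x $ T"]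
  have "gmet T h X x ** mexp S (2 * x $ T) = h"
    by (simp add: gmet_def)
  then have "gmet T h X x ** (mexp S (2 * x $ T) ** mexp S (- (2 * x $ T))) = h ** mexp S (- (2 * x $ T))"
    by (simp add: matrix_mul_assoc)
  then show ?thesis by (simp add: mexp_inverse')
qed

lemma nonnull_S: "nonnull S h T eps"
  by unfold_locales (auto simp: h_sym h_inv h_tau)

text \<open>Being self-adjoint, S is its own self-adjoint part. Hence the closed form
  \<open>gmet_eq_mexp_S\<close> applies to S as well, with the same exponent.\<close>

lemma S_S: "nonnull.S S h = S"
proof -
  interpret S: nonnull S h T eps by (rule nonnull_S)
  have M: "S.M = M"
    unfolding matrix_eq S.M_def
  proof
    fix v
    have eq: "u \<bullet> ((tp S ** h + h ** S) *v v) = u \<bullet> (M *v v)" for u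
      by (simp add: mv_simps inner_add_right M_S S_selfadjoint flip: inner_mv')
    have "(tp S ** h + h ** S) *v v - M *v v = 0"
      by (rule inner_all_zero) (simp only: inner_diff_right eq diff_self)
    then show "(tp S ** h + h ** S) *v v = M *v v" by simp
  qed
  show ?thesis
    by (subst S.S_def, subst M) (rule S_def[symmetric])
qed

lemma gmet_S:
  assumes "X ** S = S ** X"
  shows "gmet T h X = gmet T h S"
proof
  interpret S: nonnull S h T eps by (rule nonnull_S)
  show "gmet T h X x = gmet T h S x" for x
    using gmet_eq_mexp_S[OF assms] S.gmet_eq_mexp_S by (simp add: S_S)
qed

end

section \<open>Ricci curvature when the last coordinate direction is null\<close>

text \<open>\<open>h\<close> exchanges tau and nu and fixes the other basis vectors; tau and nu are
  null with product 1.\<close>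

locale null_direction = left_invariant X h T
  for X h :: "real ^ 'n::finite ^ 'n" and T :: 'n +
  fixes P :: 'n
  assumes P_T: "P \<noteq> T" and h_tau: "h *v tau = axis P 1"
    and h_axis: "\<And>i. i \<noteq> P \<Longrightarrow> i \<noteq> T \<Longrightarrow> h *v axis i 1 = axis i 1"
begin

abbreviation nu :: "real ^ 'n" where "nu \<equiv> axis P 1"

lemma h_nu: "h *v nu = tau"
  using hh[of tau] by (simp add: h_tau)

lemma nu_T [simp]: "nu $ T = 0"
  using P_T by (simp add: axis_nth)

lemma h_T: "(h *v w) $ T = nu \<bullet> w"
  using h_selfadjoint[of tau w] by (simp add: h_tau inner_axis' inner_axis)

lemma Theta_null:
  "Theta u v = - (1/2) *\<^sub>R (u $ T *\<^sub>R (h *v (M *v v)) + v $ T *\<^sub>R (h *v (M *v u)) - (u \<bullet> (M *v v)) *\<^sub>R nu)"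
  by (simp add: Theta_def mv_simps h_tau)

lemma Theta_null_T: "Theta u v $ T = - (1/2) * (u $ T * (nu \<bullet> (M *v v)) + v $ T * (nu \<bullet> (M *v u)))"
  by (simp add: Theta_null h_T)

text \<open>The contributions of nu . M nu cancel in the trace, and those left carry m twice. As a
  negative multiple of a square, Ric(Y, Y) yields a linear condition on Y without
  polarization.\<close>

lemma Ric_null:
  assumes "Y $ T = 0"
  shows "Ric Y Y = - (1/2) * (nu \<bullet> (M *v Y))\<^sup>2"
proof -
  define m where "m = nu \<bullet> (M *v Y)"
  have m2: "Y \<bullet> (M *v nu) = m"
    unfolding m_def by (subst M_selfadjoint) (rule inner_commute)
  have L: "Lam Y Y $ T = 0"
    by (simp add: Lam_def X_T Theta_null_T assms)
  have YY: "Theta Y Y = ((1/2) * (Y \<bullet> (M *v Y))) *\<^sub>R nu"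
    by (simp add: Theta_null assms)
  have Unu: "Theta U nu = - (1/2) *\<^sub>R (U $ T *\<^sub>R (h *v (M *v nu)) - (U \<bullet> (M *v nu)) *\<^sub>R nu)" for U
    by (simp add: Theta_null)
  have UY: "Theta U Y = - (1/2) *\<^sub>R (U $ T *\<^sub>R (h *v (M *v Y)) - (U \<bullet> (M *v Y)) *\<^sub>R nu)" for U
    by (simp add: Theta_null assms)
  have Ynu: "Theta Y nu = ((1/2) * m) *\<^sub>R nu"
    by (simp add: Theta_null assms m2)
  have YhMY: "Theta Y (h *v (M *v Y)) = - (1/2) *\<^sub>R (m *\<^sub>R (h *v (M *v Y)) - (Y \<bullet> (M *v (h *v (M *v Y)))) *\<^sub>R nu)"
    by (simp add: Theta_null assms m_def h_T)
  have "Ric Y Y = (\<Sum>i\<in>UNIV. axis i 1 $ T * (Lam Y Y) $ i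
     + (Y \<bullet> (M *v Y)) * (- (1/4)) * (axis i 1 $ T * (h *v (M *v nu)) $ i)
     + (Y \<bullet> (M *v Y)) * (1/4) * ((axis i 1 \<bullet> (M *v nu)) * nu $ i)
     - (m / 4) * (axis i 1 $ T * (h *v (M *v Y)) $ i)
     + (1/4) * (Y \<bullet> (M *v (h *v (M *v Y)))) * (axis i 1 $ T * nu $ i)
     - (m / 4) * ((axis i 1 \<bullet> (M *v Y)) * nu $ i))"
    unfolding Ric_def Rm_def YY UY[of "axis _ 1"]
    by (intro sum.cong refl)
      (simp add: Theta_linear Unu Ynu YhMY assms m2 field_simps)
  also have "\<dots> = - (1/2) * m\<^sup>2"
    unfolding sum.distrib sum_subtractf sum_distrib_left[symmetric] trace_sums L
    by (simp add: h_T m_def power2_eq_square)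
  finally show ?thesis by (simp add: m_def)
qed

text \<open>Images of X have no T component, so nu . M Y equals (X nu) . h Y. Testing with the basis
  vectors other than nu and tau leaves only the component along nu.\<close>

lemma ricci_flat_nu:
  assumes "ricci_flat (gmet T h X)"
  shows "X *v nu = (X *v nu) $ P *\<^sub>R nu"
proof -
  have hor: "(X *v nu) \<bullet> (h *v Y) = 0" if "Y $ T = 0" for Y
  proof -
    have "nu \<bullet> (M *v Y) = 0"
      using Ric_eq_0[OF assms, of Y Y] Ric_null[OF that] by simp
    moreover have "nu \<bullet> (M *v Y) = (X *v nu) \<bullet> (h *v Y) + tau \<bullet> (X *v Y)"
      by (simp add: M_def mv_simps inner_add_right inner_mv' h_selfadjoint[of nu] h_nu)
    ultimately show ?thesis by (simp add: inner_axis' X_T)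
  qed
  have "(X *v nu) $ i = 0" if "i \<noteq> P" for i
  proof (cases "i = T")
    case False
    then show ?thesis
      using hor[of "axis i 1"] h_axis[OF that False] by (simp add: axis_nth inner_axis)
  qed (simp add: X_T)
  then show ?thesis by (simp add: vec_ext axis_nth)
qed

section \<open>Eigenvalue zero on nu: Ricci-flatness implies flatness\<close>

context
  assumes X_nu: "X *v nu = 0"
begin

lemma M_nu: "M *v nu = 0"
  by (simp add: M_def mv_simps h_nu X_nu tX_tau)

lemma nu_M: "nu \<bullet> (M *v v) = 0"
  by (simp add: M_selfadjoint M_nu)

lemma tau_M_tau: "tau \<bullet> (M *v tau) = 0"
  by (simp add: M_def mv_simps inner_add_right X_tau flip: inner_mv')

lemma Theta_T0: "Theta u v $ T = 0"
  by (simp add: Theta_null_T nu_M)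

text \<open>With Q = h M the endomorphism is half the commutator of X and Q, minus Q^2/4, plus
  rank-one maps. The latter have trace zero, because X and M kill nu and the images of X and Q have
  T coordinate zero.\<close>

lemma Ric_tau_null: "Ric tau tau = - (1/4) * trace ((h ** M) ** (h ** M))"
proof -
  define Q where "Q = h ** M"
  define q where "q = Q *v tau"
  have Q: "h *v (M *v v) = Q *v v" for v by (simp add: Q_def mv_assoc)
  have Qnu: "Q *v nu = 0" by (simp add: Q_def mv_assoc M_nu)
  have QT: "(Q *v v) $ T = 0" for v by (simp add: Q_def mv_assoc h_T nu_M)
  have tt: "Theta tau tau = - q"
    by (simp add: Theta_null Q tau_M_tau q_def axis_nth scaleR_2[symmetric])
  have Ut: "Theta U tau = - (1/2) *\<^sub>R (U $ T *\<^sub>R q + Q *v U - (U \<bullet> (M *v tau)) *\<^sub>R nu)" for U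
    by (simp add: Theta_null Q q_def axis_nth)
  have Uq: "Theta U q = - (1/2) *\<^sub>R (U $ T *\<^sub>R (Q *v q) - (U \<bullet> (M *v q)) *\<^sub>R nu)" for U
    by (simp add: Theta_null Q QT q_def)
  have tW: "Theta tau W = - (1/2) *\<^sub>R (Q *v W - (tau \<bullet> (M *v W)) *\<^sub>R nu)" if "W $ T = 0" for W
    by (simp add: Theta_null Q that axis_nth)
  have tnu: "Theta tau nu = 0" by (simp add: tW Qnu M_nu)
  have L: "Lam tau tau $ T = 0" by (simp add: Lam_def X_T Theta_T0)
  have W: "tau \<bullet> (M *v (Q *v U)) = U \<bullet> (M *v (Q *v tau))" for U
  proof -
    have "tau \<bullet> (M *v (Q *v U)) = (M *v (h *v (M *v tau))) \<bullet> U"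
      unfolding Q_def mv_assoc by (subst M_selfadjoint, subst h_selfadjoint, subst M_selfadjoint) (rule refl)
    then show ?thesis unfolding Q by (subst inner_commute)
  qed
  have q_T: "q $ T = 0" by (simp add: q_def QT)
  have XM: "(X *v U) \<bullet> (M *v tau) = U \<bullet> (tp X *v (M *v tau))" for U
    by (rule inner_mv')
  have Qtau: "Q *v tau = q" by (simp add: q_def)
  have "Ric tau tau = (\<Sum>i\<in>UNIV. axis i 1 $ T * (Lam tau tau) $ i
     + (1/2) * (axis i 1 $ T * (X *v q) $ i) + (1/2) * ((X ** Q) *v axis i 1) $ i
     - (1/2) * ((Q ** X) *v axis i 1) $ i + (1/2) * ((axis i 1 \<bullet> (tp X *v (M *v tau))) * nu $ i)
     + (1/2) * (axis i 1 $ T * (Q *v q) $ i) - (1/2) * ((axis i 1 \<bullet> (M *v q)) * nu $ i)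
     - (1/4) * (axis i 1 $ T * (Q *v q) $ i) - (1/4) * ((Q ** Q) *v axis i 1) $ i
     + (1/4) * ((tau \<bullet> (M *v q)) * (axis i 1 $ T * nu $ i)) + (1/4) * ((axis i 1 \<bullet> (M *v q)) * nu $ i))"
    unfolding Ric_def Rm_def tt Lam_def[of "axis _ 1"] 
    by (intro sum.cong refl)
      (simp add: Theta_linear Ut Uq tW QT Qnu X_nu X_tau X_T W mv_simps axis_nth M_nu q_T XM Qtau tnu
        field_simps)
  also have "\<dots> = - (1/4) * trace (Q ** Q)"
    unfolding sum.distrib sum_subtractf sum_distrib_left[symmetric] trace_sums L
    by (simp add: X_T QT trace_mul_sym[of X Q] nu_M X_nu flip: inner_mv')
  finally show ?thesis by (simp add: Q_def)
qed

text \<open>M annihilates nu, and h fixes the basis vectors besides nu and tau. So the trace is the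
  sum of the squares of the entries of M with both indices outside {P, T}, and only row and column T
  of M survive.\<close>

lemma trace_M_zero:
  assumes "trace ((h ** M) ** (h ** M)) = 0"
  shows "M *v v = v $ T *\<^sub>R (M *v tau) + ((M *v tau) \<bullet> v) *\<^sub>R tau"
proof -
  define Q where "Q = h ** M"
  have sym: "M $ i $ j = M $ j $ i" for i j
    unfolding matrix_entry by (subst M_selfadjoint) (rule inner_commute)
  have MP: "M $ i $ P = 0" "M $ P $ i = 0" for i
    by (simp_all add: matrix_entry M_nu nu_M)
  have Q: "Q $ i $ j = (h *v axis i 1) \<bullet> (M *v axis j 1)" for i j
    by (simp add: Q_def matrix_entry mv_assoc h_selfadjoint)
  have Q1: "Q $ i $ j = M $ i $ j" if "i \<noteq> P" "i \<noteq> T" for i j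
    unfolding Q h_axis[OF that] by (simp add: matrix_entry)
  have QT: "Q $ T $ j = 0" "Q $ i $ P = 0" for i j
    by (simp_all add: Q h_tau nu_M M_nu)
  have "trace (Q ** Q) = (\<Sum>i\<in>UNIV. \<Sum>j\<in>UNIV. Q $ i $ j * Q $ j $ i)"
    by (simp add: trace_def matrix_matrix_mult_def)
  also have "\<dots> = (\<Sum>i\<in>UNIV. \<Sum>j\<in>UNIV. (if i \<in> {P, T} \<or> j \<in> {P, T} then 0 else (M $ i $ j)\<^sup>2))"
    by (intro sum.cong refl) (auto simp: QT Q1 power2_eq_square sym)
  finally have "(\<Sum>i\<in>UNIV. \<Sum>j\<in>UNIV. (if i \<in> {P, T} \<or> j \<in> {P, T} then 0 else (M $ i $ j)\<^sup>2)) = 0"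
    using assms by (simp add: Q_def)
  then have M0: "M $ i $ j = 0" if "i \<notin> {P, T}" "j \<notin> {P, T}" for i j
    using that by (simp add: sum_nonneg_eq_0_iff sum_nonneg split: if_splits) blast
  have TT: "M $ T $ T = 0" by (simp add: matrix_entry tau_M_tau)
  have t: "(M *v tau) $ i = M $ i $ T" for i
    by (simp add: matrix_vector_mult_basis column_def)
  have "M $ i $ j = axis j 1 $ T * (M *v tau) $ i + (M *v tau) $ j * tau $ i" for i j
    using M0[of i j] MP TT sym[of i j] by (cases "i = T"; cases "j = T"; cases "i = P"; cases "j = P") (auto simp: t axis_nth)
  then have "(M *v v) $ i = (\<Sum>j\<in>UNIV. (axis j 1 $ T * v $ j) * (M *v tau) $ i + tau $ i * ((M *v tau) $ j * v $ j))" for i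
    by (simp add: matrix_vector_mult_def[of M v] algebra_simps)
  moreover have "(\<Sum>j\<in>UNIV. v $ j * axis j 1 $ T) = v $ T"
    using sum_axis_nth[of T v] by (simp add: mult.commute)
  ultimately show ?thesis
    by (simp add: vec_ext sum.distrib sum_distrib_left[symmetric] sum_distrib_right[symmetric] inner_vec_def mult.commute)
qed

text \<open>Here \<open>Theta u v\<close> is -(u_T v_T) c for a fixed vector c with c_T = 0.
  Iterated \<open>Theta\<close> vanishes, and U_T times \<open>Lam V W\<close> is symmetric in U and
  V.\<close>

lemma null_flat:
  assumes "ricci_flat (gmet T h X)"
  shows "flat (gmet T h X)"
proof -
  define c where "c = M *v tau"
  have "trace ((h ** M) ** (h ** M)) = 0"
    using Ric_eq_0[OF assms, of tau tau] by (simp add: Ric_tau_null)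
  note M = trace_M_zero[OF this, folded c_def]
  have cT: "c $ T = 0" using tau_M_tau by (simp add: c_def inner_axis')
  have cP: "c $ P = 0" using nu_M[of tau] by (simp add: c_def inner_axis')
  have hc: "h *v c = c"
  proof -
    have "h *v c = (\<Sum>i\<in>UNIV. c $ i *\<^sub>R (h *v axis i 1))"
      by (subst vec_expansion[of c, symmetric]) (simp add: mv_sum mv_scaleR)
    also have "\<dots> = (\<Sum>i\<in>UNIV. c $ i *\<^sub>R axis i 1)"
    proof (intro sum.cong refl)
      fix i show "c $ i *\<^sub>R (h *v axis i 1) = c $ i *\<^sub>R axis i 1"
        using h_axis[of i] cT cP by (cases "i = P"; cases "i = T") auto
    qed
    finally show ?thesis by (simp add: vec_expansion)
  qed
  have Theta: "Theta u v = - (u $ T * v $ T) *\<^sub>R c" for u v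
    unfolding Theta_null M[of u] M[of v]
    by (simp add: mv_simps hc h_tau inner_add_right inner_axis inner_commute[of u c] algebra_simps)
      (simp add: vec_ext)
  show ?thesis
    by (rule flat_gmetI) (simp add: Rm_def Lam_def Theta X_T cT mv_simps algebra_simps)
qed

end

end

section \<open>Eigenvectors in invariant subspaces\<close>

definition cmat :: "real ^ 'n::finite ^ 'n \<Rightarrow> complex ^ 'n ^ 'n" where
  "cmat S = (\<chi> i j. of_real (S $ i $ j))"

definition re_vec :: "complex ^ 'n \<Rightarrow> real ^ 'n" where "re_vec u = (\<chi> i. Re (u $ i))"
definition im_vec :: "complex ^ 'n \<Rightarrow> real ^ 'n" where "im_vec u = (\<chi> i. Im (u $ i))"

lemma re_im_simps:
  "re_vec (u + v) = re_vec u + re_vec v" "im_vec (u + v) = im_vec u + im_vec v"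
  "re_vec 0 = 0" "im_vec 0 = 0"
  "re_vec (z *s u) = Re z *\<^sub>R re_vec u - Im z *\<^sub>R im_vec u"
  "im_vec (z *s u) = Im z *\<^sub>R re_vec u + Re z *\<^sub>R im_vec u"
  "re_vec (cmat S *v u) = S *v re_vec u" "im_vec (cmat S *v u) = S *v im_vec u"
  by (simp_all add: re_vec_def im_vec_def vec_ext cmat_def matrix_vector_mult_def)

lemma complex_vec_eqI: "re_vec u = re_vec v \<Longrightarrow> im_vec u = im_vec v \<Longrightarrow> u = v"
  by (simp add: re_vec_def im_vec_def vec_ext complex_eq_iff)

text \<open>The vector P(S) u. Complexification is implicit: u lies in the complexification of a
  real subspace when \<open>re_vec u\<close> and \<open>im_vec u\<close> lie in the
  subspace.\<close>

definition pact :: "real ^ 'n::finite ^ 'n \<Rightarrow> complex poly \<Rightarrow> complex ^ 'n \<Rightarrow> complex ^ 'n" where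
  "pact S P u = (\<Sum>i\<le>degree P. coeff P i *s (((*v) (cmat S)) ^^ i) u)"

lemma pact_bound: "degree P \<le> N \<Longrightarrow> pact S P u = (\<Sum>i\<le>N. coeff P i *s (((*v) (cmat S)) ^^ i) u)"
  unfolding pact_def by (rule sum.mono_neutral_left) (auto simp: coeff_eq_0)

lemma pact_add: "pact S (P + Q) u = pact S P u + pact S Q u"
proof -
  let ?N = "max (degree P) (degree Q)"
  show ?thesis
    by (simp add: pact_bound[of _ ?N] degree_add_le sum.distrib vector_sadd_rdistrib)
qed

lemma pact_smult: "pact S (Polynomial.smult c P) u = c *s pact S P u"
  by (cases "c = 0") (simp_all add: pact_def vector_smult_assoc vec.scale_sum_right)

lemma mv_csum: "A *v (\<Sum>i\<in>I. f i) = (\<Sum>i\<in>I. A *v (f i :: complex ^ 'n::finite))"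
  by (induction I rule: infinite_finite_induct) (auto simp: matrix_vector_right_distrib)

lemma pact_pCons_0: "pact S (pCons 0 P) u = cmat S *v pact S P u"
proof -
  have "pact S (pCons 0 P) u = (\<Sum>i\<le>Suc (degree P). coeff (pCons 0 P) i *s (((*v) (cmat S)) ^^ i) u)"
    by (rule pact_bound) (rule degree_pCons_le)
  also have "\<dots> = (\<Sum>i\<le>degree P. coeff P i *s (((*v) (cmat S)) ^^ Suc i) u)"
    by (subst sum.atMost_Suc_shift) simp
  also have "\<dots> = cmat S *v pact S P u"
    by (simp add: pact_def mv_csum vector_scalar_commute)
  finally show ?thesis .
qed

lemma pact_linear_factor: "pact S ([:- z, 1:] * Q) u = cmat S *v pact S Q u - z *s pact S Q u"
proof -
  have "[:- z, 1:] * Q = pCons 0 Q + Polynomial.smult (- z) Q" by simp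
  then show ?thesis
    by (simp only: pact_add pact_smult pact_pCons_0) (simp add: vector_sneg_minus1[symmetric] vec.scale_minus_left)
qed

text \<open>Split a linear factor off the annihilating polynomial, P = (x - z) Q. Either Q still
  annihilates u, or Q(S) u is an eigenvector for z, which stays in the complexified subspace by
  invariance.\<close>

lemma complex_eigenvector_exists:
  assumes W: "subspace W" and inv: "\<And>v. v \<in> W \<Longrightarrow> S *v v \<in> W"
    and "P \<noteq> 0" "pact S P u = 0" "u \<noteq> 0" "re_vec u \<in> W" "im_vec u \<in> W"
  shows "\<exists>v z. v \<noteq> 0 \<and> re_vec v \<in> W \<and> im_vec v \<in> W \<and> cmat S *v v = z *s v"
  using assms(3,4)
proof (induction "degree P" arbitrary: P)
  case 0
  then obtain c where "P = [:c:]" by (metis degree_eq_zeroE)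
  with 0 assms(5) show ?case by (simp add: pact_def vec.scale_eq_0_iff)
next
  case (Suc d)
  then have "\<not> constant (poly P)" by (simp add: constant_degree)
  then obtain z where "poly P z = 0" using fundamental_theorem_of_algebra by blast
  then obtain Q where Q: "P = [:- z, 1:] * Q" by (metis poly_eq_0_iff_dvd dvdE)
  with Suc have "Q \<noteq> 0" by auto
  then have "degree P = degree [:- z, 1:] + degree Q"
    unfolding Q by (intro degree_mult_eq) auto
  then have "degree P = Suc (degree Q)" by simp
  with Suc have d: "d = degree Q" by simp
  show ?case
  proof (cases "pact S Q u = 0")
    case True
    then show ?thesis using Suc(1)[OF d \<open>Q \<noteq> 0\<close>] by simp
  next
    case False
    have pow: "re_vec ((((*v) (cmat S)) ^^ i) u) \<in> W \<and> im_vec ((((*v) (cmat S)) ^^ i) u) \<in> W" for i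
      by (induction i) (simp_all add: assms(6,7) re_im_simps inv)
    have "re_vec (\<Sum>i\<in>I. coeff Q i *s (((*v) (cmat S)) ^^ i) u) \<in> W \<and>
          im_vec (\<Sum>i\<in>I. coeff Q i *s (((*v) (cmat S)) ^^ i) u) \<in> W" if "finite I" for I
      using that by (induction I)
        (simp_all add: re_im_simps subspace_0[OF W] subspace_add[OF W] subspace_diff[OF W] subspace_scale[OF W] pow)
    then have "re_vec (pact S Q u) \<in> W \<and> im_vec (pact S Q u) \<in> W"
      by (simp add: pact_def)
    moreover have "cmat S *v pact S Q u = z *s pact S Q u"
      using Suc(4) by (simp add: Q pact_linear_factor del: mult_pCons_left)
    ultimately show ?thesis using False by blast
  qed
qed

text \<open>One vector more than the dimension. The coefficients are indexed by exponents, so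
  coinciding powers have to be treated apart.\<close>

lemma powers_dependent:
  fixes S :: "real ^ 'n::finite ^ 'n"
  shows "\<exists>c. (\<exists>i\<le>CARD('n). c i \<noteq> 0) \<and> (\<Sum>i\<le>CARD('n). c i *\<^sub>R (((*v) S) ^^ i) w) = 0"
proof -
  let ?f = "\<lambda>i. (((*v) S) ^^ i) w" and ?I = "{..CARD('n)}"
  show ?thesis
  proof (cases "inj_on ?f ?I")
    case True
    then have "card (?f ` ?I) > DIM(real ^ 'n)" by (simp add: card_image)
    then have "dependent (?f ` ?I)" by (meson dependent_biggerset finite_atMost finite_imageI)
    then obtain u where u: "\<exists>v\<in>?f ` ?I. u v \<noteq> 0" "(\<Sum>v\<in>?f ` ?I. u v *\<^sub>R v) = 0"
      by (auto simp: dependent_finite)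
    then have "(\<Sum>i\<in>?I. u (?f i) *\<^sub>R ?f i) = 0"
      using True by (simp add: sum.reindex)
    with u(1) show ?thesis by (intro exI[of _ "\<lambda>i. u (?f i)"]) auto
  next
    case False
    then obtain i j where ij: "i \<in> ?I" "j \<in> ?I" "i \<noteq> j" "?f i = ?f j"
      by (auto simp: inj_on_def)
    define c :: "nat \<Rightarrow> real" where "c k = (if k = i then 1 else 0) - (if k = j then 1 else 0)" for k
    have "(\<Sum>k\<in>?I. c k *\<^sub>R ?f k) = ?f i - ?f j"
      using ij by (simp add: c_def scaleR_diff_left sum_subtractf if_distrib[of "\<lambda>x. x *\<^sub>R _"] cong: if_cong)
    with ij show ?thesis by (intro exI[of _ c]) (auto simp: c_def intro!: exI[of _ i])
  qed
qed

text \<open>The pair \<open>p, q\<close> is the real and imaginary part of an eigenvector for \<open>a + i b\<close>.\<close>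

lemma eigenpair_exists:
  fixes S :: "real ^ 'n::finite ^ 'n"
  assumes W: "subspace W" and inv: "\<And>v. v \<in> W \<Longrightarrow> S *v v \<in> W" and w: "w \<in> W" "w \<noteq> 0"
  obtains p q a b where "p \<in> W" "q \<in> W" "p \<noteq> 0 \<or> q \<noteq> 0"
    "S *v p = a *\<^sub>R p - b *\<^sub>R q" "S *v q = b *\<^sub>R p + a *\<^sub>R q"
proof -
  obtain c where c: "\<exists>i\<le>CARD('n). c i \<noteq> 0" "(\<Sum>i\<le>CARD('n). c i *\<^sub>R (((*v) S) ^^ i) w) = 0"
    using powers_dependent by blast
  define u :: "complex ^ 'n" where "u = (\<chi> i. of_real (w $ i))"
  have u: "re_vec u = w" "im_vec u = 0" by (simp_all add: u_def re_vec_def im_vec_def vec_ext)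
  define P where "P = (\<Sum>i\<le>CARD('n). Polynomial.monom (complex_of_real (c i)) i)"
  have coeffP: "coeff P i = (if i \<le> CARD('n) then of_real (c i) else 0)" for i
    by (simp add: P_def coeff_sum if_distrib cong: if_cong)
  have "P \<noteq> 0" using c(1) coeffP by (metis coeff_0 of_real_eq_0_iff)
  moreover have "degree P \<le> CARD('n)" by (rule degree_le) (simp add: coeffP)
  then have Pu: "pact S P u = (\<Sum>i\<le>CARD('n). of_real (c i) *s (((*v) (cmat S)) ^^ i) u)"
    by (simp add: pact_bound coeffP)
  have pow: "re_vec ((((*v) (cmat S)) ^^ i) u) = (((*v) S) ^^ i) w" "im_vec ((((*v) (cmat S)) ^^ i) u) = 0" for i
    by (induction i) (simp_all add: u re_im_simps)
  have "re_vec (\<Sum>i\<in>I. of_real (c i) *s (((*v) (cmat S)) ^^ i) u) = (\<Sum>i\<in>I. c i *\<^sub>R (((*v) S) ^^ i) w)"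
    "im_vec (\<Sum>i\<in>I. of_real (c i) *s (((*v) (cmat S)) ^^ i) u) = 0" if "finite I" for I
    using that by (induction I) (simp_all add: re_im_simps pow)
  with c(2) Pu have "pact S P u = 0" by (intro complex_vec_eqI) (simp_all add: re_im_simps)
  moreover have "u \<noteq> 0" using w(2) u(1) by (auto simp: re_im_simps)
  ultimately obtain v z where v: "v \<noteq> 0" "re_vec v \<in> W" "im_vec v \<in> W" "cmat S *v v = z *s v"
    using complex_eigenvector_exists[OF W inv, of P u] w(1) u subspace_0[OF W] by auto
  have "re_vec v \<noteq> 0 \<or> im_vec v \<noteq> 0"
    using v(1) complex_vec_eqI[of v 0] by (auto simp: re_im_simps)
  moreover have "S *v re_vec v = Re z *\<^sub>R re_vec v - Im z *\<^sub>R im_vec v"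
    using arg_cong[OF v(4), of re_vec] by (simp add: re_im_simps)
  moreover have "S *v im_vec v = Im z *\<^sub>R re_vec v + Re z *\<^sub>R im_vec v"
    using arg_cong[OF v(4), of im_vec] by (simp add: re_im_simps)
  ultimately show ?thesis using that v(2,3) by blast
qed

section \<open>The Lorentz form\<close>

definition sg :: "'n \<Rightarrow> 'n \<Rightarrow> real" where "sg z0 i = (if i = z0 then -1 else 1)"

definition lmat :: "'n::finite \<Rightarrow> real ^ 'n ^ 'n" where
  "lmat z0 = (\<chi> i j. if i = j then sg z0 i else 0)"

definition lor :: "'n::finite \<Rightarrow> real ^ 'n \<Rightarrow> real ^ 'n \<Rightarrow> real" where
  "lor z0 u v = u \<bullet> v - 2 * u $ z0 * v $ z0"

lemma lmat_mv: "lmat z0 *v v = v - (2 * v $ z0) *\<^sub>R axis z0 1"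
  by (simp add: vec_ext matrix_vector_mult_def lmat_def sg_def axis_nth if_distrib[of "\<lambda>x. x * _"] cong: if_cong)

lemma lor_lmat: "lor z0 u v = u \<bullet> (lmat z0 *v v)"
  by (simp add: lor_def lmat_mv inner_diff_right inner_axis)

lemma lor_linear:
  "lor z0 (u + v) w = lor z0 u w + lor z0 v w" "lor z0 w (u + v) = lor z0 w u + lor z0 w v"
  "lor z0 (u - v) w = lor z0 u w - lor z0 v w" "lor z0 w (u - v) = lor z0 w u - lor z0 w v"
  "lor z0 (c *\<^sub>R u) w = c * lor z0 u w" "lor z0 w (c *\<^sub>R u) = c * lor z0 w u"
  "lor z0 (- u) w = - lor z0 u w" "lor z0 w (- u) = - lor z0 w u"
  "lor z0 0 w = 0" "lor z0 w 0 = 0"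
  by (simp_all add: lor_def inner_add_left inner_add_right inner_diff_left inner_diff_right algebra_simps)

lemma lor_commute: "lor z0 u v = lor z0 v u"
  by (simp add: lor_def inner_commute)

lemma lor_positive:
  assumes "lor z0 t t < 0" "lor z0 t v = 0" "v \<noteq> 0"
  shows "lor z0 v v > 0"
proof (cases "v $ z0 = 0")
  case True
  then show ?thesis using assms(3) by (simp add: lor_def)
next
  case False
  \<comment> \<open>The z0 coordinates cancel in this combination, so the form is Euclidean on y;
    orthogonality of t and v removes the mixed terms.\<close>
  define y where "y = t $ z0 *\<^sub>R v - v $ z0 *\<^sub>R t"
  have "y \<bullet> y = lor z0 y y" by (simp add: lor_def y_def)
  also have "\<dots> = (t $ z0)\<^sup>2 * lor z0 v v + (v $ z0)\<^sup>2 * lor z0 t t"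
    using assms(2) lor_commute[of z0 t v] by (simp add: y_def lor_linear power2_eq_square)
  finally have "(t $ z0)\<^sup>2 * lor z0 v v = y \<bullet> y - (v $ z0)\<^sup>2 * lor z0 t t" by simp
  moreover have "(v $ z0)\<^sup>2 * lor z0 t t < 0" using False assms(1) by (simp add: mult_pos_neg)
  ultimately have "(t $ z0)\<^sup>2 * lor z0 v v > 0" using inner_ge_zero[of y] by linarith
  then show ?thesis by (simp add: zero_less_mult_iff)
qed

lemma lor_null_nth:
  assumes "lor z0 l l = 0" "l \<noteq> 0"
  shows "l $ z0 \<noteq> 0"
  using assms by (auto simp: lor_def)

text \<open>Subtracting the multiple of l that clears the z0 coordinate leaves the square of x
  unchanged, and without that coordinate the square is Euclidean.\<close>

lemma lor_null_orthogonal: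
  assumes "lor z0 l l = 0" "l \<noteq> 0" "lor z0 l x = 0"
  shows "lor z0 x x \<ge> 0" and "lor z0 x x = 0 \<Longrightarrow> x = (x $ z0 / l $ z0) *\<^sub>R l"
proof -
  define y where "y = x - (x $ z0 / l $ z0) *\<^sub>R l"
  have "y $ z0 = 0" using lor_null_nth[OF assms(1,2)] by (simp add: y_def)
  then have "y \<bullet> y = lor z0 y y" by (simp add: lor_def)
  also have "\<dots> = lor z0 x x"
    using assms lor_commute[of z0 x l] by (simp add: y_def lor_linear)
  finally have y: "y \<bullet> y = lor z0 x x" .
  then show "lor z0 x x \<ge> 0" by (metis inner_ge_zero)
  assume "lor z0 x x = 0"
  with y show "x = (x $ z0 / l $ z0) *\<^sub>R l" by (simp add: y_def)
qed

text \<open>Only the indices in J are constrained, so a partial frame can be extended one index at a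
  time; the timelike vector sits at z0.\<close>

definition lframe :: "'n::finite \<Rightarrow> 'n set \<Rightarrow> ('n \<Rightarrow> real ^ 'n) \<Rightarrow> bool" where
  "lframe z0 J p \<longleftrightarrow> (\<forall>i\<in>J. \<forall>j\<in>J. lor z0 (p i) (p j) = (if i = j then sg z0 i else 0))"

text \<open>On an eigenpair p, q self-adjointness gives b (lor p p + lor q q) = 0, and positivity
  forces b = 0.\<close>

lemma eigenvector_exists_spacelike:
  fixes S :: "real ^ 'n::finite ^ 'n"
  assumes W: "subspace W" and inv: "\<And>v. v \<in> W \<Longrightarrow> S *v v \<in> W" and w: "w \<in> W" "w \<noteq> 0"
    and sa: "\<And>u v. lor z0 (S *v u) v = lor z0 u (S *v v)" and pos: "\<And>v. v \<in> W \<Longrightarrow> v \<noteq> 0 \<Longrightarrow> lor z0 v v > 0"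
  obtains v a where "v \<in> W" "v \<noteq> 0" "S *v v = a *\<^sub>R v"
proof -
  obtain p q a b where pq: "p \<in> W" "q \<in> W" "p \<noteq> 0 \<or> q \<noteq> 0"
    "S *v p = a *\<^sub>R p - b *\<^sub>R q" "S *v q = b *\<^sub>R p + a *\<^sub>R q"
    using eigenpair_exists[OF W inv w] by blast
  have "b * (lor z0 p p + lor z0 q q) = 0"
    using sa[of p q] by (simp add: pq(4,5) lor_linear algebra_simps)
  moreover have "lor z0 p p \<ge> 0" "lor z0 q q \<ge> 0" "lor z0 p p > 0 \<or> lor z0 q q > 0"
    using pos[OF pq(1)] pos[OF pq(2)] pq(3) by (auto simp: lor_linear intro: less_imp_le dest: order.strict_implies_order)
      (metis lor_linear(9) order.strict_implies_order order_refl)+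
  ultimately have "b = 0" by auto
  with pq that show ?thesis by auto
qed

text \<open>The frame over J contains a timelike vector, so the orthogonal complement of its span is
  positive definite; it is invariant by self-adjointness. A unit eigenvector in it fills the next
  index.\<close>

lemma lframe_completion:
  fixes S :: "real ^ 'n::finite ^ 'n"
  assumes sa: "\<And>u v. lor z0 (S *v u) v = lor z0 u (S *v v)"
    and "z0 \<in> J" "lframe z0 J p" "\<And>i. i \<in> J \<Longrightarrow> S *v p i \<in> span (p ` J)"
  shows "\<exists>p' lam. lframe z0 UNIV p' \<and> (\<forall>i\<in>J. p' i = p i) \<and> (\<forall>i. i \<notin> J \<longrightarrow> S *v p' i = lam i *\<^sub>R p' i)"
  using assms(2-4)
proof (induction "card (- J)" arbitrary: J p)
  case 0
  then have "J = UNIV" by auto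
  with 0 show ?case by auto
next
  case (Suc n)
  have "- J \<noteq> {}" using Suc(2) by (metis card.empty nat.distinct(1))
  then obtain k where k: "k \<notin> J" by auto
  define W where "W = {w. \<forall>i\<in>J. lor z0 (p i) w = 0}"
  have W: "subspace W" by (auto simp: subspace_def W_def lor_linear)
  have span0: "lor z0 v w = 0" if "v \<in> span (p ` J)" "w \<in> W" for v w
    using that(1)
  proof (induction rule: span_induct_alt)
    case (step c x y)
    with that(2) show ?case by (auto simp: lor_linear W_def)
  qed (simp add: lor_linear)
  have inv: "S *v w \<in> W" if "w \<in> W" for w
    using span0[OF Suc(5) that] by (auto simp: W_def simp flip: sa)
  \<comment> \<open>A nonzero vector of W exists because there are fewer conditions than dimensions;
    they are written as Euclidean orthogonality to \<open>lmat z0 *v p i\<close>.\<close>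
  have "dim ((\<lambda>i. lmat z0 *v p i) ` J) \<le> card J"
    by (meson dim_le_card' finite card_image_le order_trans finite_imageI)
  also have "card J < CARD('n)"
    using k by (metis UNIV_I finite psubset_card_mono psubsetI subset_UNIV)
  finally obtain w where w: "w \<noteq> 0" "\<And>y. y \<in> span ((\<lambda>i. lmat z0 *v p i) ` J) \<Longrightarrow> w \<bullet> y = 0"
    using orthogonal_to_subspace_exists[of "(\<lambda>i. lmat z0 *v p i) ` J"]
    by (auto simp: Linear_Algebra.orthogonal_def)
  have "w \<in> W"
    unfolding W_def
  proof (clarify)
    fix i assume "i \<in> J"
    then have "w \<bullet> (lmat z0 *v p i) = 0" using w(2)[OF span_base] by auto
    then show "lor z0 (p i) w = 0" by (subst lor_commute) (simp add: lor_lmat)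
  qed
  have neg: "lor z0 (p z0) (p z0) < 0" using Suc(3,4) by (simp add: lframe_def sg_def)
  have pos: "lor z0 v v > 0" if "v \<in> W" "v \<noteq> 0" for v
    using lor_positive[OF neg _ that(2)] that(1) Suc(3) by (auto simp: W_def)
  obtain v a where v: "v \<in> W" "v \<noteq> 0" "S *v v = a *\<^sub>R v"
    using eigenvector_exists_spacelike[OF W inv \<open>w \<in> W\<close> w(1) sa pos] by blast
  define e where "e = (1 / sqrt (lor z0 v v)) *\<^sub>R v"
  have ee: "lor z0 e e = 1" using pos[OF v(1,2)] by (simp add: e_def lor_linear)
  have ep: "lor z0 (p i) e = 0" "lor z0 e (p i) = 0" if "i \<in> J" for i
    using v(1) that lor_commute[of z0 e "p i"] by (auto simp: W_def e_def lor_linear)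
  have Se: "S *v e = a *\<^sub>R e" by (simp add: e_def v(3) mv_scaleR)
  define p1 where "p1 = p(k := e)"
  have p1J: "p1 ` insert k J = insert e (p ` J)" using k by (auto simp: p1_def)
  have ko: "k \<noteq> z0" using k Suc(3) by auto
  have "\<exists>p' lam. lframe z0 UNIV p' \<and> (\<forall>i\<in>insert k J. p' i = p1 i)
      \<and> (\<forall>i. i \<notin> insert k J \<longrightarrow> S *v p' i = lam i *\<^sub>R p' i)"
  proof (rule Suc(1))
    have "- insert k J = - J - {k}" by auto
    then show "n = card (- insert k J)" using Suc(2) k by simp
    show "z0 \<in> insert k J" using Suc(3) by simp
    show "lframe z0 (insert k J) p1"
      using Suc(4) ee ep k ko by (auto simp: lframe_def p1_def sg_def)
    show "S *v p1 i \<in> span (p1 ` insert k J)" if "i \<in> insert k J" for i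
    proof (cases "i = k")
      case True
      then show ?thesis by (simp add: p1J) (simp add: p1_def Se span_base span_scale)
    next
      case False
      then have "S *v p i \<in> span (p ` J)" using that Suc(5) by simp
      then show ?thesis using False unfolding p1J by (simp add: p1_def) (meson span_mono subsetD subset_insertI)
    qed
  qed
  then obtain p' lam where p': "lframe z0 UNIV p'" "\<forall>i\<in>insert k J. p' i = p1 i"
    "\<forall>i. i \<notin> insert k J \<longrightarrow> S *v p' i = lam i *\<^sub>R p' i" by blast
  have "\<forall>i\<in>J. p' i = p i" using p'(2) k by (auto simp: p1_def)
  moreover have "S *v p' i = (lam(k := a)) i *\<^sub>R p' i" if "i \<notin> J" for i
    using p'(2,3) that Se by (auto simp: p1_def)
  ultimately show ?case using p'(1) by blast
qed

section \<open>Pseudo-orthonormal frames\<close>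

definition fmat :: "('n::finite \<Rightarrow> real ^ 'n) \<Rightarrow> real ^ 'n ^ 'n" where
  "fmat p = (\<chi> i j. p j $ i)"

lemma fmat_axis: "fmat p *v axis j 1 = p j"
  by (simp add: fmat_def vec_ext matrix_vector_mult_basis column_def)

lemma fmat_mv: "fmat p *v c = (\<Sum>j\<in>UNIV. c $ j *\<^sub>R p j)"
  by (simp add: fmat_def vec_ext matrix_vector_mult_def mult.commute)

lemma lmat_sym: "tp (lmat z0) = lmat z0"
  by (simp add: lmat_def vec_ext Finite_Cartesian_Product.transpose_def)

lemma lmat_inv: "lmat z0 ** lmat z0 = idm"
  unfolding matrix_eq by (simp add: mv_assoc lmat_mv axis_nth vec_ext)

lemma lmat_lmat [simp]: "lmat z0 *v (lmat z0 *v v) = v"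
  by (simp add: matrix_vector_mul_assoc lmat_inv)

context
  fixes z0 :: "'n::finite" and p :: "'n \<Rightarrow> real ^ 'n"
  assumes frame: "lframe z0 UNIV p"
begin

lemma fmat_isometry: "tp (fmat p) ** lmat z0 ** fmat p = lmat z0"
proof (rule mat_eqI)
  fix i j
  have "(tp (fmat p) ** lmat z0 ** fmat p) $ i $ j = lor z0 (p i) (p j)"
    by (simp add: matrix_entry mv_assoc fmat_axis lor_lmat flip: inner_mv')
  then show "(tp (fmat p) ** lmat z0 ** fmat p) $ i $ j = lmat z0 $ i $ j"
    using frame by (simp add: lframe_def lmat_def)
qed

text \<open>The inverse of \<open>fmat p\<close>: its adjoint for the Lorentz form, which
  \<open>fmat p\<close> preserves.\<close>

definition "fdual = lmat z0 ** tp (fmat p) ** lmat z0"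

lemma fdual_fmat: "fdual ** fmat p = idm"
proof -
  have "fdual ** fmat p = lmat z0 ** (tp (fmat p) ** lmat z0 ** fmat p)"
    by (simp add: fdual_def matrix_mul_assoc)
  then show ?thesis by (simp add: fmat_isometry lmat_inv)
qed

lemma fmat_fdual: "fmat p ** fdual = idm"
  using fdual_fmat matrix_left_right_inverse by blast

lemma fdual_mv [simp]: "fdual *v (fmat p *v v) = v" "fmat p *v (fdual *v v) = v"
  by (simp_all add: matrix_vector_mul_assoc fdual_fmat fmat_fdual)

lemma frame_expansion: "v = (\<Sum>j\<in>UNIV. (fdual *v v) $ j *\<^sub>R p j)"
  by (simp flip: fmat_mv)

lemma frame_linear_eq:
  assumes "linear f" "linear g" "\<And>j. f (p j) = g (p j)"
  shows "f v = g v"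
  by (subst (1 2) frame_expansion) (simp add: linear_sum[OF assms(1)] linear_sum[OF assms(2)]
      linear_scale[OF assms(1)] linear_scale[OF assms(2)] assms(3))

text \<open>The dual basis of the frame consists of the functionals
  \<open>sg z0 j * lor z0 (p j) v\<close> of v.\<close>

lemma frame_trace: "trace Y = (\<Sum>j\<in>UNIV. sg z0 j * lor z0 (p j) (Y *v p j))"
proof -
  have "trace Y = trace (Y ** (fmat p ** fdual))" by (simp add: fmat_fdual)
  also have "\<dots> = trace (fdual ** (Y ** fmat p))"
    unfolding matrix_mul_assoc by (rule trans[OF trace_mul_sym]) (simp add: matrix_mul_assoc)
  also have "\<dots> = (\<Sum>j\<in>UNIV. sg z0 j * lor z0 (p j) (Y *v p j))"
    unfolding trace_def
  proof (intro sum.cong refl)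
    fix j
    have "lmat z0 *v axis j 1 = sg z0 j *\<^sub>R axis j 1"
      by (simp add: vec_ext lmat_mv sg_def axis_nth)
    then show "(fdual ** (Y ** fmat p)) $ j $ j = sg z0 j * lor z0 (p j) (Y *v p j)"
      by (simp add: matrix_entry mv_assoc fdual_def fmat_axis lor_lmat inner_mv[of "axis j 1" "lmat z0"]
          lmat_sym mv_scaleR flip: inner_mv')
  qed
  finally show ?thesis .
qed

text \<open>Taking coordinates in the frame is the isometry. For s = -1 the direction T is reversed,
  and X' is minus the matrix of S in the frame.\<close>

lemma frame_isometric:
  assumes s: "s * s = 1" and T: "T \<noteq> z0" and pT: "p T = s *\<^sub>R axis T 1"
    and S: "\<And>j. S *v p j = s *\<^sub>R (\<Sum>i\<in>UNIV. X' $ i $ j *\<^sub>R p i)"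
  shows "isometric (gmet T (lmat z0) S) (gmet T (lmat z0) X')"
proof (rule isometric_gmet[OF lmat_inv])
  let ?P = "fmat p" and ?h = "lmat z0"
  have PhP: "?P ** ?h ** tp ?P = ?h"
  proof -
    have "?P ** ?h ** tp ?P = ?P ** fdual ** ?h"
      unfolding matrix_eq by (simp add: fdual_def mv_assoc)
    then show ?thesis by (simp add: fmat_fdual)
  qed
  have "?P *v (?h *v (tp ?P *v v)) = (?P ** ?h ** tp ?P) *v v" for v
    by (simp only: mv_assoc)
  then show "tp fdual ** ?h ** fdual = ?h"
    unfolding matrix_eq by (simp add: fdual_def matrix_transpose_mul lmat_sym mv_assoc PhP)
  have SP: "S *v (?P *v v) = s *\<^sub>R (?P *v (X' *v v))" for v
  proof -
    have "S *v p j = s *\<^sub>R (?P *v (X' *v axis j 1))" for j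
      by (simp add: S fmat_mv matrix_vector_mult_basis column_def)
    then have "S *v (?P *v v) = s *\<^sub>R (?P *v (X' *v (\<Sum>j\<in>UNIV. v $ j *\<^sub>R axis j 1)))"
      by (simp add: fmat_mv[of p v] mv_sum mv_scaleR scaleR_sum_right mult.commute)
    then show ?thesis by (simp add: vec_expansion)
  qed
  have "(fdual ** S) *v v = s *\<^sub>R ((X' ** fdual) *v v)" for v
    using SP[of "fdual *v v"] by (simp add: mv_assoc mv_scaleR)
  then show "fdual ** S = s *\<^sub>R (X' ** fdual)"
    unfolding matrix_eq by (simp add: scaleR_mv)
  have "(?P *v y) $ T = s * y $ T" for y
  proof -
    have "p j $ T = s * (if j = T then 1 else 0)" for j
    proof -
      have "p j $ T = lor z0 (p j) (axis T 1)"
        using T by (simp add: lor_def inner_axis axis_nth)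
      also have "axis T 1 = s *\<^sub>R p T" by (simp add: pT s)
      finally show ?thesis using frame T by (simp add: lor_linear lframe_def sg_def)
    qed
    then show ?thesis
      by (simp add: fmat_mv if_distrib[of "\<lambda>x. _ * x"] mult_ac cong: if_cong)
  qed
  note * = this
  show "(fdual *v x) $ T = s * x $ T" for x
  proof -
    have "s * x $ T = (s * s) * (fdual *v x) $ T"
      using *[of "fdual *v x"] by simp
    then show ?thesis by (simp add: s)
  qed
qed

end

section \<open>Self-adjoint operators for the Lorentz form\<close>

text \<open>The matrix of family (1) extended by zeros at T, with named indices instead of
  positions; column j is the image of the basis vector j.\<close>

definition rot_form :: "'n::finite \<Rightarrow> 'n \<Rightarrow> 'n \<Rightarrow> real \<Rightarrow> real \<Rightarrow> ('n \<Rightarrow> real) \<Rightarrow> real ^ 'n ^ 'n" where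
  "rot_form z0 z1 T a b lam = (\<chi> i j.
     if j = z0 then (if i = z0 then a else if i = z1 then b else 0)
     else if j = z1 then (if i = z0 then - b else if i = z1 then a else 0)
     else if i = j \<and> j \<noteq> T then lam j else 0)"

text \<open>Family (2) in the same encoding. With l = e_z1 - e_z0 and k = e_z0 + e_z1 it sends l to
  0, e_z2 to l and k to 2 e_z2 + 2 d l: a nilpotent Jordan block of size three.\<close>

definition nil_form :: "'n::finite \<Rightarrow> 'n \<Rightarrow> 'n \<Rightarrow> real \<Rightarrow> real ^ 'n ^ 'n" where
  "nil_form z0 z1 z2 d = (\<chi> i j.
     if j = z0 \<or> j = z1 then (if i = z0 then - d else if i = z1 then d else if i = z2 then 1 else 0)
     else if j = z2 then (if i = z0 then - 1 else if i = z1 then 1 else 0)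
     else 0)"

lemma sum_scaleR_support:
  fixes f :: "'n::finite \<Rightarrow> real"
  assumes "\<And>i. i \<notin> A \<Longrightarrow> f i = 0"
  shows "(\<Sum>i\<in>UNIV. f i *\<^sub>R p i) = (\<Sum>i\<in>A. f i *\<^sub>R (p i :: 'b::real_vector))"
  by (rule sum.mono_neutral_right) (auto simp: assms)

locale lorentz_selfadjoint =
  fixes S :: "real ^ 'n::finite ^ 'n" and z0 T :: 'n
  assumes sa: "\<And>u v. lor z0 (S *v u) v = lor z0 u (S *v v)"
    and S_tau: "S *v axis T 1 = 0" and T_z0: "T \<noteq> z0"
begin

lemma lor_tau [simp]: "lor z0 v (axis T 1) = v $ T" "lor z0 (axis T 1) v = v $ T"
  using T_z0 by (simp_all add: lor_def inner_axis inner_axis' axis_nth)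

lemma S_T: "(S *v v) $ T = 0"
  using sa[of v "axis T 1"] by (simp add: S_tau lor_linear)

text \<open>Induction on the dimension of W: a spacelike eigenvector is split off, and the
  projection of t to its complement stays timelike, since removing a spacelike component cannot
  raise the square.\<close>

lemma invariant_eigen_dichotomy:
  assumes "subspace W" "\<And>v. v \<in> W \<Longrightarrow> S *v v \<in> W" "t \<in> W" "lor z0 t t < 0"
  shows "(\<exists>p q a b. p \<in> W \<and> q \<in> W \<and> (p \<noteq> 0 \<or> q \<noteq> 0) \<and> b \<noteq> 0 \<and>
      S *v p = a *\<^sub>R p - b *\<^sub>R q \<and> S *v q = b *\<^sub>R p + a *\<^sub>R q) \<or>
    (\<exists>v a. v \<in> W \<and> v \<noteq> 0 \<and> lor z0 v v \<le> 0 \<and> S *v v = a *\<^sub>R v)"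
  using assms
proof (induction "dim W" arbitrary: W t rule: less_induct)
  case less
  have "t \<noteq> 0" using less(5) by (auto simp: lor_linear)
  then obtain p q a b where pq: "p \<in> W" "q \<in> W" "p \<noteq> 0 \<or> q \<noteq> 0"
    "S *v p = a *\<^sub>R p - b *\<^sub>R q" "S *v q = b *\<^sub>R p + a *\<^sub>R q"
    using eigenpair_exists[OF less(2,3,4)] by blast
  show ?case
  proof (cases "b = 0")
    case False
    with pq show ?thesis by blast
  next
    case True
    with pq obtain v where v: "v \<in> W" "v \<noteq> 0" "S *v v = a *\<^sub>R v" by auto
    show ?thesis
    proof (cases "lor z0 v v \<le> 0")
      case True
      with v show ?thesis by blast
    next
      case False
      define W' where "W' = {w \<in> W. lor z0 v w = 0}"
      define t' where "t' = t - (lor z0 v t / lor z0 v v) *\<^sub>R v"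
      have W': "subspace W'"
        using less(2) by (auto simp: subspace_def W'_def lor_linear)
      have "v \<notin> W'" using False by (simp add: W'_def)
      then have "W' \<subset> W" using v(1) by (auto simp: W'_def)
      then have "dim W' < dim W"
        using less(2) W' by (metis dim_psubset span_eq_iff)
      moreover have "S *v w \<in> W'" if "w \<in> W'" for w
        using that less(3) v(3) by (auto simp: W'_def lor_linear simp flip: sa)
      moreover have "t' \<in> W'"
        using less(2,4) v(1) False by (auto simp: W'_def t'_def lor_linear subspace_diff subspace_scale)
      moreover have "lor z0 t' t' < 0"
      proof -
        have "lor z0 t' t' = lor z0 t t - (lor z0 v t)\<^sup>2 / lor z0 v v"
          using False lor_commute[of z0 t v] by (simp add: t'_def lor_linear power2_eq_square field_simps)
        also have "\<dots> \<le> lor z0 t t" using False by simp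
        finally show ?thesis using less(5) by simp
      qed
      ultimately have "(\<exists>p q a b. p \<in> W' \<and> q \<in> W' \<and> (p \<noteq> 0 \<or> q \<noteq> 0) \<and> b \<noteq> 0 \<and>
          S *v p = a *\<^sub>R p - b *\<^sub>R q \<and> S *v q = b *\<^sub>R p + a *\<^sub>R q) \<or>
        (\<exists>v a. v \<in> W' \<and> v \<noteq> 0 \<and> lor z0 v v \<le> 0 \<and> S *v v = a *\<^sub>R v)"
        using less(1)[OF _ W', of t'] by blast
      then show ?thesis using \<open>W' \<subset> W\<close> by blast
    qed
  qed
qed

text \<open>For u = p + i q the complex bilinear extension of the form has (u, u) = 2 (A + i C), and
  passing to w u multiplies it by w^2. It is nonzero: otherwise p and q are null and orthogonal,
  hence parallel, which contradicts the nonzero b.\<close>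

lemma normalize_eigenpair:
  assumes pq: "p \<noteq> 0 \<or> q \<noteq> 0" "b \<noteq> 0"
    "S *v p = a *\<^sub>R p - b *\<^sub>R q" "S *v q = b *\<^sub>R p + a *\<^sub>R q" and T: "p $ T = 0" "q $ T = 0"
  obtains p' q' where "lor z0 p' p' = - 1" "lor z0 q' q' = 1" "lor z0 p' q' = 0"
    "S *v p' = a *\<^sub>R p' - b *\<^sub>R q'" "S *v q' = b *\<^sub>R p' + a *\<^sub>R q'" "p' $ T = 0" "q' $ T = 0"
proof -
  define A where "A = lor z0 p p"
  define C where "C = lor z0 p q"
  have "b * (lor z0 p p + lor z0 q q) = 0"
    using sa[of p q] by (simp add: pq(3,4) lor_linear algebra_simps)
  with pq(2) have qq: "lor z0 q q = - A" by (simp add: A_def)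
  have "Complex A C \<noteq> 0"
  proof
    assume "Complex A C = 0"
    then have AC: "A = 0" "C = 0" by (simp_all add: complex_eq_iff)
    have "p \<noteq> 0"
      using pq by auto
    then obtain c where c: "q = c *\<^sub>R p"
      using lor_null_orthogonal(2)[of z0 p q] AC qq by (auto simp: A_def C_def)
    have "b *\<^sub>R p + a *\<^sub>R q = c *\<^sub>R (a *\<^sub>R p - b *\<^sub>R q)"
      using pq(3,4) by (simp add: c mv_scaleR)
    then have "(b * (1 + c * c)) *\<^sub>R p = 0"
      by (simp add: c algebra_simps)
    moreover have "1 + c * c \<noteq> 0" by (metis add.commute sum_squares_eq_zero_iff mult_1 zero_neq_one)
    ultimately show False using pq(2) \<open>p \<noteq> 0\<close> by simp
  qed
  \<comment> \<open>This multiplier turns A + i C into -1, so p' gets square -1 and becomes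
    orthogonal to q'.\<close>
  define w where "w = csqrt (- 1 / Complex A C)"
  have "w\<^sup>2 * Complex A C = - 1"
    using \<open>Complex A C \<noteq> 0\<close> by (simp add: w_def)
  then have w: "(Re w * Re w - Im w * Im w) * A - 2 * Re w * Im w * C = - 1"
    "(Re w * Re w - Im w * Im w) * C + 2 * Re w * Im w * A = 0"
    by (auto simp: complex_eq_iff power2_eq_square algebra_simps)
  define p' where "p' = Re w *\<^sub>R p - Im w *\<^sub>R q"
  define q' where "q' = Im w *\<^sub>R p + Re w *\<^sub>R q"
  have pq_lor: "lor z0 p p = A" "lor z0 p q = C" "lor z0 q p = C" "lor z0 q q = - A"
    using qq lor_commute[of z0 q p] by (simp_all add: A_def C_def)
  have "lor z0 p' p' = - 1" "lor z0 q' q' = 1" "lor z0 p' q' = 0"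
    using w by (simp_all add: p'_def q'_def lor_linear pq_lor algebra_simps)
  moreover have "S *v p' = a *\<^sub>R p' - b *\<^sub>R q'" "S *v q' = b *\<^sub>R p' + a *\<^sub>R q'"
    by (simp_all add: p'_def q'_def mv_simps pq(3,4) algebra_simps)
  moreover have "p' $ T = 0" "q' $ T = 0" using T by (simp_all add: p'_def q'_def)
  ultimately show ?thesis by (rule that)
qed

lemma isometric_rot_form:
  assumes pq: "lor z0 p p = - 1" "lor z0 q q = 1" "lor z0 p q = 0"
    "S *v p = a *\<^sub>R p - b *\<^sub>R q" "S *v q = b *\<^sub>R p + a *\<^sub>R q" "p $ T = 0" "q $ T = 0" "b \<noteq> 0"
    and z1: "z1 \<noteq> z0" "z1 \<noteq> T"
  shows "\<exists>a b lam. a \<le> 0 \<and> b > 0 \<and> isometric (gmet T (lmat z0) S) (gmet T (lmat z0) (rot_form z0 z1 T a b lam))"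
proof -
  \<comment> \<open>The sign s reverses the direction T to make s * a nonpositive; r flips q where
    needed, so that the entry in row z1 and column z0 becomes the absolute value of b.\<close>
  define s :: real where "s = (if a \<le> 0 then 1 else - 1)"
  define r :: real where "r = (if b > 0 then - s else s)"
  have s: "s * s = 1" and r: "r * r = 1" "r * b = - (s * \<bar>b\<bar>)" by (auto simp: s_def r_def)
  \<comment> \<open>tau belongs to the initial frame, so the eigenvectors added by the completion
    are orthogonal to it.\<close>
  define f where "f = (\<lambda>i. if i = z0 then p else if i = z1 then r *\<^sub>R q else s *\<^sub>R axis T 1)"
  have f: "f z0 = p" "f z1 = r *\<^sub>R q" "f T = s *\<^sub>R axis T 1"
    using z1 T_z0 by (auto simp: f_def)
  have qp: "lor z0 q p = 0" using pq(3) lor_commute[of z0 q p] by simp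
  have "lframe z0 {z0, z1, T} f"
    unfolding lframe_def using z1 T_z0 s r
    by (auto simp: f lor_linear pq qp sg_def mult.assoc axis_nth)
  moreover have "S *v f i \<in> span (f ` {z0, z1, T})" if "i \<in> {z0, z1, T}" for i
  proof -
    have sp: "p \<in> span (f ` {z0, z1, T})" "r *\<^sub>R q \<in> span (f ` {z0, z1, T})"
      using f by (auto intro!: span_base)
    moreover have q: "q = r *\<^sub>R (r *\<^sub>R q)" using r by simp
    ultimately have "q \<in> span (f ` {z0, z1, T})" by (metis span_scale)
    with sp(1) that show ?thesis
      by (auto simp: f mv_scaleR S_tau pq(4,5) span_zero span_scale span_add span_diff)
  qed
  ultimately obtain p' lam where p': "lframe z0 UNIV p'" "\<forall>i\<in>{z0, z1, T}. p' i = f i"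
    "\<forall>i. i \<notin> {z0, z1, T} \<longrightarrow> S *v p' i = lam i *\<^sub>R p' i"
    using lframe_completion[OF sa, of "{z0, z1, T}" f] by blast
  let ?X = "rot_form z0 z1 T (s * a) \<bar>b\<bar> (\<lambda>i. s * lam i)"
  have "isometric (gmet T (lmat z0) S) (gmet T (lmat z0) ?X)"
  proof (rule frame_isometric[OF p'(1) s T_z0])
    show "p' T = s *\<^sub>R axis T 1" using p'(2) f by simp
    have ss: "s * (s * x) = x" for x using s by (simp flip: mult.assoc)
    have br: "s * (\<bar>b\<bar> * r) = - b" by (simp add: s_def r_def)
    fix j
    have sum: "(\<Sum>i\<in>UNIV. ?X $ i $ j *\<^sub>R p' i) = (\<Sum>i\<in>{z0, z1}. ?X $ i $ j *\<^sub>R p' i)" if "j \<in> {z0, z1}"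
      by (rule sum_scaleR_support) (use that z1 in \<open>auto simp: rot_form_def\<close>)
    have sum': "(\<Sum>i\<in>UNIV. ?X $ i $ j *\<^sub>R p' i) = (\<Sum>i\<in>{j}. ?X $ i $ j *\<^sub>R p' i)" if "j \<notin> {z0, z1}"
      by (rule sum_scaleR_support) (use that in \<open>auto simp: rot_form_def\<close>)
    consider "j = z0" | "j = z1" | "j = T" | "j \<notin> {z0, z1, T}" by blast
    then show "S *v p' j = s *\<^sub>R (\<Sum>i\<in>UNIV. ?X $ i $ j *\<^sub>R p' i)"
    proof cases
      case 1
      then have "(\<Sum>i\<in>UNIV. ?X $ i $ j *\<^sub>R p' i) = (s * a) *\<^sub>R p + \<bar>b\<bar> *\<^sub>R (r *\<^sub>R q)"
        using sum p'(2) f z1 by (simp add: rot_form_def)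
      then have "s *\<^sub>R (\<Sum>i\<in>UNIV. ?X $ i $ j *\<^sub>R p' i) = (s * (s * a)) *\<^sub>R p + (s * (\<bar>b\<bar> * r)) *\<^sub>R q"
        by (simp add: scaleR_add_right)
      also have "\<dots> = a *\<^sub>R p - b *\<^sub>R q"
        unfolding ss br by simp
      finally show ?thesis using 1 p'(2) f pq(4) by simp
    next
      case 2
      then have "(\<Sum>i\<in>UNIV. ?X $ i $ j *\<^sub>R p' i) = (- \<bar>b\<bar>) *\<^sub>R p + (s * a) *\<^sub>R (r *\<^sub>R q)"
        using sum p'(2) f z1 by (simp add: rot_form_def)
      then have "s *\<^sub>R (\<Sum>i\<in>UNIV. ?X $ i $ j *\<^sub>R p' i) = (- (s * \<bar>b\<bar>)) *\<^sub>R p + (s * (s * (a * r))) *\<^sub>R q"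
        by (simp add: scaleR_add_right scaleR_diff_right mult_ac)
      also have "\<dots> = r *\<^sub>R (b *\<^sub>R p + a *\<^sub>R q)"
        unfolding ss r(2)[symmetric] by (simp add: scaleR_add_right mult_ac)
      finally show ?thesis using 2 p'(2) f pq(5) by (simp add: mv_scaleR)
    next
      case 3
      with sum' p'(2) f z1 T_z0 show ?thesis by (simp add: rot_form_def mv_scaleR S_tau)
    next
      case 4
      with sum' p'(3) show ?thesis by (simp add: rot_form_def ss)
    qed
  qed
  moreover have "s * a \<le> 0" "\<bar>b\<bar> > 0" using pq(8) by (auto simp: s_def)
  ultimately show ?thesis by blast
qed

text \<open>The complement of a timelike eigenvector is positive definite, so S is diagonal with
  real eigenvalues in some frame, and tr S^2 is the sum of their squares.\<close>

lemma timelike_eigenvector_zero: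
  assumes v: "S *v v = a *\<^sub>R v" "lor z0 v v < 0" "v $ T = 0" and tr: "trace (S ** S) = 0"
  shows "S *v w = 0"
proof -
  define e where "e = (1 / sqrt (- lor z0 v v)) *\<^sub>R v"
  have e: "lor z0 e e = - 1" "e $ T = 0" "S *v e = a *\<^sub>R e"
    using v by (simp_all add: e_def lor_linear mv_scaleR field_simps)
  define f where "f = (\<lambda>i. if i = z0 then e else axis T 1 :: real ^ 'n)"
  have "lframe z0 {z0, T} f"
    unfolding lframe_def using T_z0 by (auto simp: f_def e lor_linear sg_def axis_nth)
  moreover have "S *v f i \<in> span (f ` {z0, T})" if "i \<in> {z0, T}" for i
  proof (cases "i = z0")
    case True
    then have "S *v f i = a *\<^sub>R f z0" by (simp add: f_def e(3))
    then show ?thesis by (simp add: span_scale span_base)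
  next
    case False
    then show ?thesis by (simp add: f_def S_tau span_zero)
  qed
  ultimately obtain p lam where p: "lframe z0 UNIV p" "\<forall>i\<in>{z0, T}. p i = f i"
    "\<forall>i. i \<notin> {z0, T} \<longrightarrow> S *v p i = lam i *\<^sub>R p i"
    using lframe_completion[OF sa, of "{z0, T}" f] by blast
  have "\<exists>c. S *v p j = c *\<^sub>R p j" for j
    using p(2,3) T_z0 e(3) S_tau by (cases "j = z0"; cases "j = T") (auto simp: f_def intro: exI[of _ 0])
  then obtain c where c: "\<And>j. S *v p j = c j *\<^sub>R p j" by metis
  have "0 = (\<Sum>j\<in>UNIV. sg z0 j * lor z0 (p j) ((S ** S) *v p j))"
    using frame_trace[OF p(1), of "S ** S"] tr by simp
  also have "\<dots> = (\<Sum>j\<in>UNIV. (c j)\<^sup>2)"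
    using p(1) by (intro sum.cong refl) (simp add: mv_simps c lor_linear lframe_def sg_def power2_eq_square)
  finally have "c j = 0" for j by (simp add: sum_nonneg_eq_0_iff eq_commute[of 0])
  then show ?thesis
    using frame_linear_eq[OF p(1) matrix_vector_mul_linear bounded_linear.linear[OF bounded_linear_zero], of S w] c by simp
qed

text \<open>In a frame adapted to the null vectors \<open>l\<close> and \<open>k\<close>, the trace of \<open>S\<^sup>2\<close> is \<open>2 a\<^sup>2\<close> plus a sum of
  squares of vectors orthogonal to \<open>l\<close>, which are nonnegative.\<close>

lemma null_frame_trace:
  assumes l: "lor z0 l l = 0" "l \<noteq> 0" "S *v l = a *\<^sub>R l" and k: "lor z0 k k = 0" "lor z0 l k = 2"
    and p: "lframe z0 UNIV p" "p z0 = (1/2) *\<^sub>R (k - l)" "p z1 = (1/2) *\<^sub>R (k + l)" and z1: "z1 \<noteq> z0"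
    and tr: "trace (S ** S) = 0"
  shows "a = 0" and "j \<notin> {z0, z1} \<Longrightarrow> \<exists>c. S *v p j = c *\<^sub>R l" and "j \<notin> {z0, z1} \<Longrightarrow> lor z0 l (p j) = 0"
proof -
  have lp: "l = p z1 - p z0" by (simp add: p(2,3) algebra_simps flip: scaleR_add_left)
  have lpj: "lor z0 l (p j) = 0" if "j \<notin> {z0, z1}" for j
    unfolding lp using p(1) that by (auto simp: lor_linear lframe_def)
  then show "j \<notin> {z0, z1} \<Longrightarrow> lor z0 l (p j) = 0" .
  have lS: "lor z0 l (S *v p j) = 0" if "j \<notin> {z0, z1}" for j
    using lpj[OF that] by (simp add: l lor_linear flip: sa)
  have kl: "lor z0 k l = 2" using k(2) lor_commute[of z0 k l] by simp
  have "0 = (\<Sum>j\<in>UNIV. sg z0 j * lor z0 (S *v p j) (S *v p j))"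
    using frame_trace[OF p(1), of "S ** S"] tr by (simp add: mv_assoc sa)
  also have "\<dots> = (\<Sum>j\<in>{z0, z1}. sg z0 j * lor z0 (S *v p j) (S *v p j)) +
      (\<Sum>j\<in>UNIV - {z0, z1}. sg z0 j * lor z0 (S *v p j) (S *v p j))"
    by (metis (no_types, lifting) add.commute finite subset_UNIV sum.subset_diff)
  also have "(\<Sum>j\<in>{z0, z1}. sg z0 j * lor z0 (S *v p j) (S *v p j)) =
      lor z0 (S *v p z1) (S *v p z1) - lor z0 (S *v p z0) (S *v p z0)"
    using z1 by (simp add: sg_def)
  \<comment> \<open>Polarization, with p z1 = (k + l)/2 and p z0 = (k - l)/2.\<close>
  also have "\<dots> = lor z0 (S *v l) (S *v k)"
    using lor_commute[of z0 "S *v l" "S *v k"] by (simp add: p(2,3) mv_simps lor_linear algebra_simps)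
  also have "\<dots> = 2 * a\<^sup>2"
    by (simp add: l lor_linear power2_eq_square kl flip: sa) (simp add: k(2) l lor_linear)
  also have "(\<Sum>j\<in>UNIV - {z0, z1}. sg z0 j * lor z0 (S *v p j) (S *v p j)) =
      (\<Sum>j\<in>UNIV - {z0, z1}. lor z0 (S *v p j) (S *v p j))"
    by (intro sum.cong refl) (simp add: sg_def)
  finally have eq: "2 * a\<^sup>2 + (\<Sum>j\<in>UNIV - {z0, z1}. lor z0 (S *v p j) (S *v p j)) = 0" by simp
  moreover have nn: "lor z0 (S *v p j) (S *v p j) \<ge> 0" if "j \<in> UNIV - {z0, z1}" for j
    using lor_null_orthogonal(1)[OF l(1,2) lS] that by simp
  then have "(\<Sum>j\<in>UNIV - {z0, z1}. lor z0 (S *v p j) (S *v p j)) \<ge> 0" by (rule sum_nonneg)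
  moreover have "a\<^sup>2 \<ge> 0" by simp
  ultimately have "a\<^sup>2 = 0" and s0: "(\<Sum>j\<in>UNIV - {z0, z1}. lor z0 (S *v p j) (S *v p j)) = 0"
    by linarith+
  then show "a = 0" by simp
  assume j: "j \<notin> {z0, z1}"
  then have "lor z0 (S *v p j) (S *v p j) = 0"
    using s0 nn by (subst (asm) sum_nonneg_eq_0_iff) auto
  then show "\<exists>c. S *v p j = c *\<^sub>R l"
    using lor_null_orthogonal(2)[OF l(1,2) lS[OF j]] by blast
qed


section \<open>Frames adapted to a null eigenvector\<close>

lemma null_partner_exists:
  assumes "lor z0 l l = 0" "l \<noteq> 0" "l $ T = 0"
  obtains k where "lor z0 k k = 0" "lor z0 l k = 2" "k $ T = 0"
proof
  \<comment> \<open>The vector \<open>lmat z0 *v l\<close>, that is l with its z0 coordinate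
    reversed, is null and pairs with l to twice the square of that coordinate; the factor adjusts
    this to 2.\<close>
  let ?k = "(1 / (l $ z0)\<^sup>2) *\<^sub>R (l - (2 * l $ z0) *\<^sub>R axis z0 1)"
  have l0: "l $ z0 \<noteq> 0" by (rule lor_null_nth[OF assms(1,2)])
  have ll: "l \<bullet> l = 2 * (l $ z0)\<^sup>2"
    using assms(1) by (simp add: lor_def power2_eq_square)
  have ax: "lor z0 v (axis z0 1) = - v $ z0" "lor z0 (axis z0 1) v = - v $ z0" for v
    by (simp_all add: lor_def inner_axis inner_axis' axis_nth)
  show "lor z0 ?k ?k = 0"
    using assms(1) by (simp add: lor_linear ax axis_nth)
  show "lor z0 l ?k = 2"
    using assms(1) l0 by (simp add: lor_linear ax power2_eq_square field_simps)
  show "?k $ T = 0" using assms(3) T_z0 by (simp add: axis_nth)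
qed

text \<open>The value \<open>lor z0 l k = 2\<close> gives (k - l)/2 and (k + l)/2 the squares -1 and
  1. The alternative that z2 is in {z0, z1, T} covers the use without a further vector to
  place.\<close>

lemma null_frame_exists:
  assumes l: "lor z0 l l = 0" "l $ T = 0" and k: "lor z0 k k = 0" "lor z0 l k = 2" "k $ T = 0"
    and e: "lor z0 l e = 0" "lor z0 k e = 0" "e $ T = 0" "lor z0 e e = 1 \<or> z2 \<in> {z0, z1, T}"
    and z1: "z1 \<noteq> z0" "z1 \<noteq> T"
  obtains p where "lframe z0 UNIV p" "p z0 = (1/2) *\<^sub>R (k - l)" "p z1 = (1/2) *\<^sub>R (k + l)"
    "p T = axis T 1" "z2 \<notin> {z0, z1, T} \<Longrightarrow> p z2 = e"
proof -
  define f where "f = (\<lambda>i. if i = z0 then (1/2) *\<^sub>R (k - l) else if i = z1 then (1/2) *\<^sub>R (k + l)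
    else if i = T then axis T 1 else e)"
  have kl: "lor z0 k l = 2" "lor z0 e l = 0" "lor z0 e k = 0"
    using k(2) e(1,2) by (simp_all add: lor_commute[of z0 _ l] lor_commute[of z0 e k])
  have f: "f z0 = (1/2) *\<^sub>R (k - l)" "f z1 = (1/2) *\<^sub>R (k + l)" "f T = axis T 1"
    using z1 T_z0 by (auto simp: f_def)
  have F: "lframe z0 {z0, z1, T} f"
    unfolding lframe_def using z1 T_z0
    by (auto simp: f lor_linear l k kl sg_def axis_nth)
  have "lframe z0 {z0, z1, T, z2} f"
  proof (cases "z2 \<in> {z0, z1, T}")
    case True
    then have "{z0, z1, T, z2} = {z0, z1, T}" by auto
    with F show ?thesis by simp
  next
    case False
    then have "f z2 = e" "lor z0 e e = 1" using e(4) by (auto simp: f_def)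
    with False F show ?thesis
      by (auto simp: lframe_def f lor_linear l k kl e sg_def)
  qed
  \<comment> \<open>For the zero operator the completion is mere extension of an orthonormal
    frame.\<close>
  moreover have "(0 :: real ^ 'n ^ 'n) *v f i \<in> span (f ` {z0, z1, T, z2})" for i
    by (simp add: span_zero)
  ultimately obtain p where p: "lframe z0 UNIV p" "\<forall>i\<in>{z0, z1, T, z2}. p i = f i"
    using lframe_completion[of z0 0 "{z0, z1, T, z2}" f] by (auto simp: lor_linear)
  show ?thesis
    by (rule that[OF p(1)]) (use p(2) z1 T_z0 in \<open>auto simp: f_def\<close>)
qed

text \<open>One has S l = 0 and S k = m l + r with r orthogonal to l and k. If r = 0, then S has
  rank at most one; otherwise r is spacelike and, once scaled, becomes the third vector of the
  Jordan block.\<close>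

lemma null_eigenvector_cases:
  assumes l: "lor z0 l l = 0" "l \<noteq> 0" "S *v l = a *\<^sub>R l" "l $ T = 0" and tr: "trace (S ** S) = 0"
    and z1: "z1 \<noteq> z0" "z1 \<noteq> T" and z2: "z2 \<notin> {z0, z1, T}"
  shows "(\<exists>mu l. lor z0 l l = 0 \<and> l $ T = 0 \<and> (\<forall>v. S *v v = (mu * lor z0 l v) *\<^sub>R l)) \<or>
    (\<exists>d. isometric (gmet T (lmat z0) S) (gmet T (lmat z0) (nil_form z0 z1 z2 d)))"
proof -
  obtain k where k: "lor z0 k k = 0" "lor z0 l k = 2" "k $ T = 0"
    by (rule null_partner_exists[OF l(1,2,4)])
  obtain p where p: "lframe z0 UNIV p" "p z0 = (1/2) *\<^sub>R (k - l)" "p z1 = (1/2) *\<^sub>R (k + l)"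
    "p T = axis T 1"
    by (rule null_frame_exists[OF l(1,4) k, of 0 T z1]) (use z1 in \<open>auto simp: lor_linear\<close>)
  note N = null_frame_trace[OF l(1-3) k(1,2) p(1-3) z1(1) tr]
  have Sl: "S *v l = 0" using N(1) l(3) by simp
  \<comment> \<open>Since \<open>lor z0 k l\<close> is 2, this m makes r orthogonal to k.\<close>
  define m where "m = lor z0 (S *v k) k / 2"
  define r where "r = S *v k - m *\<^sub>R l"
  have lr: "lor z0 l r = 0" by (simp add: r_def lor_linear l(1) Sl flip: sa)
  have kr: "lor z0 k r = 0"
    using k(2) lor_commute[of z0 k l] lor_commute[of z0 k "S *v k"] by (simp add: r_def lor_linear m_def)
  have rT: "r $ T = 0" by (simp add: r_def S_T l(4))
  show ?thesis
  proof (cases "r = 0")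
    case True
    then have Sk: "S *v k = m *\<^sub>R l" by (simp add: r_def)
    have kl: "lor z0 k l = 2" using k(2) lor_commute[of z0 k l] by simp
    have agree: "S *v p j = ((m / 2) * lor z0 l (p j)) *\<^sub>R l" for j
    proof -
      consider "j = z0" | "j = z1" | "j \<notin> {z0, z1}" by blast
      then show ?thesis
      proof cases
        case 3
        then obtain c where c: "S *v p j = c *\<^sub>R l" using N(2) by blast
        have "2 * c = lor z0 (S *v k) (p j)" by (simp add: sa c lor_linear kl)
        also have "\<dots> = 0" using N(3)[OF 3] by (simp add: Sk lor_linear)
        finally show ?thesis using c N(3)[OF 3] by simp
      qed (simp_all add: p mv_simps Sk Sl lor_linear l k)
    qed
    have lin: "linear (\<lambda>v. ((m / 2) * lor z0 l v) *\<^sub>R l)"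
      by (rule linearI) (simp_all add: lor_linear algebra_simps add_divide_distrib)
    have "S *v v = ((m / 2) * lor z0 l v) *\<^sub>R l" for v
      by (rule frame_linear_eq[OF p(1) matrix_vector_mul_linear lin agree])
    with l show ?thesis by blast
  next
    case False
    have "lor z0 r r \<noteq> 0"
    proof
      assume "lor z0 r r = 0"
      then obtain c where "r = c *\<^sub>R l" using lor_null_orthogonal(2)[OF l(1,2) lr] by blast
      with kr k(2) False lor_commute[of z0 k l] show False by (simp add: lor_linear)
    qed
    with lor_null_orthogonal(1)[OF l(1,2) lr] have rr: "lor z0 r r > 0" by simp
    \<comment> \<open>Scaling l by t and k by 1/t keeps their product 2; this t makes r / t twice a
      unit vector.\<close>
    define t where "t = sqrt (lor z0 r r) / 2"
    have t: "t > 0" "4 * (t * t) = lor z0 r r" using rr by (simp_all add: t_def)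
    define l' where "l' = t *\<^sub>R l"
    define k' where "k' = (1 / t) *\<^sub>R k"
    define e where "e = (1 / (2 * t)) *\<^sub>R r"
    have l': "lor z0 l' l' = 0" "l' \<noteq> 0" "S *v l' = 0 *\<^sub>R l'" "l' $ T = 0"
      using l t Sl by (simp_all add: l'_def lor_linear mv_scaleR)
    have k': "lor z0 k' k' = 0" "lor z0 l' k' = 2" "k' $ T = 0"
      using k t by (simp_all add: l'_def k'_def lor_linear)
    have e: "lor z0 l' e = 0" "lor z0 k' e = 0" "e $ T = 0" "lor z0 e e = 1"
      using lr kr rT t rr by (simp_all add: l'_def k'_def e_def lor_linear field_simps)
    define d where "d = m / (2 * (t * t))"
    have Sk': "S *v k' = 2 *\<^sub>R e + (2 * d) *\<^sub>R l'"
      using t(1) by (simp add: k'_def mv_scaleR e_def l'_def d_def r_def algebra_simps)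
    have kl': "lor z0 k' l' = 2" using k'(2) lor_commute[of z0 k' l'] by simp
    obtain q where q: "lframe z0 UNIV q" "q z0 = (1/2) *\<^sub>R (k' - l')" "q z1 = (1/2) *\<^sub>R (k' + l')"
      "q T = axis T 1" "q z2 = e"
      by (rule null_frame_exists[OF l'(1,4) k', of e z2 z1]) (use z1 z2 e in auto)
    note N' = null_frame_trace[OF l'(1-3) k'(1,2) q(1-3) z1(1) tr]
    \<comment> \<open>Pairing with k' finds the coefficient: the image of k' is 2 e plus a multiple
      of l', and q j is orthogonal to l'.\<close>
    have Sq: "S *v q j = (if j = z2 then l' else 0)" if j: "j \<notin> {z0, z1}" for j
    proof -
      obtain c where c: "S *v q j = c *\<^sub>R l'" using N'(2)[OF j] by blast
      have "2 * c = lor z0 (S *v k') (q j)" by (simp add: sa c lor_linear kl')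
      also have "\<dots> = 2 * lor z0 (q z2) (q j)" using N'(3)[OF j] by (simp add: Sk' lor_linear q(5))
      finally show ?thesis using q(1) c z2 by (simp add: lframe_def sg_def eq_commute[of z2])
    qed
    have lq: "l' = q z1 - q z0" by (simp add: q(2,3) algebra_simps flip: scaleR_add_left)
    have Sz: "S *v q z0 = e + d *\<^sub>R l'" "S *v q z1 = e + d *\<^sub>R l'"
      using l'(3) by (simp_all add: q(2,3) mv_simps Sk' scaleR_add_right)
    have "isometric (gmet T (lmat z0) S) (gmet T (lmat z0) (nil_form z0 z1 z2 d))"
    proof (rule frame_isometric[OF q(1) _ T_z0])
      show "(1::real) * 1 = 1" "q T = 1 *\<^sub>R axis T 1" using q(4) by simp_all
      fix j
      have "(\<Sum>i\<in>UNIV. nil_form z0 z1 z2 d $ i $ j *\<^sub>R q i) = (\<Sum>i\<in>{z0, z1, z2}. nil_form z0 z1 z2 d $ i $ j *\<^sub>R q i)"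
        by (rule sum_scaleR_support) (auto simp: nil_form_def)
      also have "\<dots> = nil_form z0 z1 z2 d $ z0 $ j *\<^sub>R q z0 + nil_form z0 z1 z2 d $ z1 $ j *\<^sub>R q z1
          + nil_form z0 z1 z2 d $ z2 $ j *\<^sub>R e"
        using z1 z2 by (auto simp: q(5))
      also have "\<dots> = S *v q j"
      proof (cases "j \<in> {z0, z1}")
        case True
        then have "S *v q j = e + d *\<^sub>R (q z1 - q z0)" using Sz lq by auto
        then show ?thesis using True z1 z2 by (auto simp: nil_form_def algebra_simps)
      next
        case False
        then show ?thesis using z1 z2 Sq[OF False] lq by (auto simp: nil_form_def)
      qed
      finally show "S *v q j = 1 *\<^sub>R (\<Sum>i\<in>UNIV. nil_form z0 z1 z2 d $ i $ j *\<^sub>R q i)" by simp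
    qed
    then show ?thesis by blast
  qed
qed

theorem selfadjoint_classification:
  assumes tr: "trace (S ** S) = 0" and z1: "z1 \<noteq> z0" "z1 \<noteq> T" and z2: "z2 \<notin> {z0, z1, T}"
  shows "(\<exists>mu l. lor z0 l l = 0 \<and> l $ T = 0 \<and> (\<forall>v. S *v v = (mu * lor z0 l v) *\<^sub>R l)) \<or>
    (\<exists>a b lam. a \<le> 0 \<and> b > 0 \<and> isometric (gmet T (lmat z0) S) (gmet T (lmat z0) (rot_form z0 z1 T a b lam))) \<or>
    (\<exists>d. isometric (gmet T (lmat z0) S) (gmet T (lmat z0) (nil_form z0 z1 z2 d)))"
proof -
  let ?W = "{v :: real ^ 'n. v $ T = 0}"
  have "subspace ?W" by (simp add: subspace_def)
  moreover have "lor z0 (axis z0 1) (axis z0 1) < 0" by (simp add: lor_def inner_axis axis_nth)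
  moreover have "axis z0 1 \<in> ?W" using T_z0 by (simp add: axis_nth)
  ultimately consider
    p q a b where "p $ T = 0" "q $ T = 0" "p \<noteq> 0 \<or> q \<noteq> 0" "b \<noteq> 0"
      "S *v p = a *\<^sub>R p - b *\<^sub>R q" "S *v q = b *\<^sub>R p + a *\<^sub>R q"
    | v a where "v $ T = 0" "v \<noteq> 0" "lor z0 v v \<le> 0" "S *v v = a *\<^sub>R v"
    using invariant_eigen_dichotomy[of ?W "axis z0 1"] S_T by auto
  then show ?thesis
  proof cases
    case 1
    obtain p' q' where "lor z0 p' p' = - 1" "lor z0 q' q' = 1" "lor z0 p' q' = 0"
      "S *v p' = a *\<^sub>R p' - b *\<^sub>R q'" "S *v q' = b *\<^sub>R p' + a *\<^sub>R q'" "p' $ T = 0" "q' $ T = 0"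
      by (rule normalize_eigenpair[OF 1(3-6,1,2)])
    from isometric_rot_form[OF this 1(4) z1] show ?thesis by blast
  next
    case 2
    show ?thesis
    proof (cases "lor z0 v v < 0")
      case True
      then have "S *v w = 0" for w using timelike_eigenvector_zero[OF 2(4) True 2(1) tr] by blast
      then have "lor z0 0 0 = 0 \<and> (0 :: real ^ 'n) $ T = 0 \<and> (\<forall>v. S *v v = (0 * lor z0 0 v) *\<^sub>R 0)"
        by (simp add: lor_linear)
      then show ?thesis by blast
    next
      case False
      with 2(3) have "lor z0 v v = 0" by simp
      from null_eigenvector_cases[OF this 2(2,4,1) tr z1 z2] show ?thesis by blast
    qed
  qed
qed

end

section \<open>Ricci-flat left-invariant metrics\<close>

context nonnull
begin

text \<open>The functional f v = l . h v vanishes on tau and l, hence on the image of S. This kills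
  \<open>Lam\<close>, and \<open>Theta U (Theta V W)\<close> is a constant times f U f V f W times
  l, symmetric in U and V.\<close>

lemma flat_rank_one:
  assumes "X = S" and l: "l \<bullet> (h *v l) = 0" "l $ T = 0"
    and S: "\<And>v. S *v v = (mu * (l \<bullet> (h *v v))) *\<^sub>R l"
  shows "flat (gmet T h X)"
proof (rule flat_gmetI)
  define f where "f v = l \<bullet> (h *v v)" for v
  have Sv: "S *v v = (mu * f v) *\<^sub>R l" for v by (simp add: S f_def)
  have Xv: "X *v v = (mu * f v) *\<^sub>R l" for v
    using arg_cong[OF assms(1), of "\<lambda>A. A *v v"] Sv by (rule trans)
  have f: "f l = 0" "f tau = 0" "f (u + v) = f u + f v" "f (u - v) = f u - f v" "f (c *\<^sub>R u) = c * f u" "f (- u) = - f u" for u v c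
    using l by (simp_all add: f_def h_tau inner_axis mv_simps inner_add_right inner_diff_right)
  have uS: "u \<bullet> (h *v (S *v v)) = mu * (f u * f v)" for u v
  proof -
    have "u \<bullet> (h *v l) = f u" unfolding f_def by (subst h_selfadjoint) (rule inner_commute)
    then show ?thesis by (simp add: Sv mv_simps)
  qed
  have Th: "Theta u v = (eps * (mu * (f u * f v))) *\<^sub>R tau - (mu * (u $ T * f v + v $ T * f u)) *\<^sub>R l" for u v
    by (simp add: Theta_S uS) (simp add: Sv algebra_simps)
  have La: "Lam u v = 0" for u v
    unfolding Lam_def by (simp add: Th Xv f l mv_simps)
  show "Rm U V W = 0" for U V W
    unfolding Rm_def La by (simp add: Th f l axis_nth algebra_simps)
qed

end

theorem ricci_flat_timelike_direction:
  fixes X :: "real ^ 'n::finite ^ 'n"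
  assumes X: "X *v axis T 1 = 0" "\<And>v. (X *v v) $ T = 0" and rf: "ricci_flat (gmet T (lmat T) X)"
  shows "flat (gmet T (lmat T) X)"
proof -
  interpret nonnull X "lmat T" T "- 1"
    by unfold_locales (simp_all add: lmat_sym lmat_inv X lmat_mv axis_nth scaleR_2)
  \<comment> \<open>Images of S have T coordinate zero, and \<open>lmat T\<close> changes only that
    coordinate, so self-adjointness is Euclidean symmetry.\<close>
  have "(S *v u) \<bullet> v = u \<bullet> (S *v v)" for u v
    using S_selfadjoint[of u v] by (simp add: lmat_mv inner_diff_right inner_axis)
  then have sym: "S $ i $ j = S $ j $ i" for i j
    unfolding matrix_entry by (metis inner_commute)
  have "(\<Sum>i\<in>UNIV. \<Sum>j\<in>UNIV. (S $ i $ j)\<^sup>2) = trace (S ** S)"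
    unfolding trace_def matrix_matrix_mult_def vec_lambda_beta power2_eq_square
    by (intro sum.cong refl) (metis sym)
  also have "\<dots> = 0" by (rule ricci_flat_S(1)[OF rf])
  finally have "S = 0" by (simp add: sum_nonneg_eq_0_iff sum_nonneg vec_ext)
  then show ?thesis by (rule flat_if_S_zero)
qed

theorem ricci_flat_spacelike_direction:
  fixes X :: "real ^ 'n::finite ^ 'n"
  assumes X: "X *v axis T 1 = 0" "\<And>v. (X *v v) $ T = 0" and rf: "ricci_flat (gmet T (lmat z0) X)"
    and d: "T \<noteq> z0" "z1 \<noteq> z0" "z1 \<noteq> T" "z2 \<notin> {z0, z1, T}"
  shows "flat (gmet T (lmat z0) X) \<or>
    (\<exists>a b lam. a \<le> 0 \<and> b > 0 \<and> isometric (gmet T (lmat z0) X) (gmet T (lmat z0) (rot_form z0 z1 T a b lam))) \<or>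
    (\<exists>d. isometric (gmet T (lmat z0) X) (gmet T (lmat z0) (nil_form z0 z1 z2 d)))"
proof -
  interpret nonnull X "lmat z0" T 1
    by unfold_locales (use d in \<open>simp_all add: lmat_sym lmat_inv X lmat_mv axis_nth\<close>)
  interpret S: nonnull S "lmat z0" T 1 by (rule nonnull_S)
  interpret lorentz_selfadjoint S z0 T
    by unfold_locales (use d S_selfadjoint in \<open>simp_all add: lor_lmat\<close>)
  have eq: "gmet T (lmat z0) X = gmet T (lmat z0) S"
    by (rule gmet_S[OF ricci_flat_S(2)[OF rf]])
  from selfadjoint_classification[OF ricci_flat_S(1)[OF rf] d(2-4)]
  consider mu l where "lor z0 l l = 0" "l $ T = 0" "\<And>v. S *v v = (mu * lor z0 l v) *\<^sub>R l"
    | "(\<exists>a b lam. a \<le> 0 \<and> b > 0 \<and> isometric (gmet T (lmat z0) S) (gmet T (lmat z0) (rot_form z0 z1 T a b lam))) \<or>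
    (\<exists>d. isometric (gmet T (lmat z0) S) (gmet T (lmat z0) (nil_form z0 z1 z2 d)))"
    by blast
  then show ?thesis
  proof cases
    case 1
    have "flat (gmet T (lmat z0) S)"
      by (rule S.flat_rank_one[of l mu]) (use 1 in \<open>simp_all add: S_S flip: lor_lmat\<close>)
    then show ?thesis by (simp add: eq)
  next
    case 2
    then show ?thesis by (simp add: eq)
  qed
qed

text \<open>The permutation matrix of an involution, hence symmetric and its own inverse; it is the
  matrix (c) when P is the last index but one.\<close>

definition nmat :: "'n::finite \<Rightarrow> 'n \<Rightarrow> real ^ 'n ^ 'n" where
  "nmat T P = (\<chi> i j. if j = Transposition.transpose T P i then 1 else 0)"

lemma nmat_mv: "(nmat T P *v v) $ i = v $ Transposition.transpose T P i"
  by (simp add: nmat_def matrix_vector_mult_def if_distrib[of "\<lambda>x. x * _"] cong: if_cong)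

theorem ricci_flat_null_direction:
  fixes X :: "real ^ 'n::finite ^ 'n"
  assumes X: "X *v axis T 1 = 0" "\<And>v. (X *v v) $ T = 0" and rf: "ricci_flat (gmet T (nmat T P) X)"
    and P: "P \<noteq> T"
  shows "flat (gmet T (nmat T P) X) \<or>
    (\<exists>X'. X' *v axis T 1 = 0 \<and> (\<forall>v. (X' *v v) $ T = 0) \<and> X' *v axis P 1 = axis P 1 \<and>
      isometric (gmet T (nmat T P) X) (gmet T (nmat T P) X'))"
proof -
  have h2: "nmat T P ** nmat T P = idm"
    unfolding matrix_eq by (simp add: mv_assoc vec_ext nmat_mv)
  have hsym: "tp (nmat T P) = nmat T P"
    by (simp add: nmat_def vec_ext Finite_Cartesian_Product.transpose_def)
  interpret null_direction X "nmat T P" T P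
    by unfold_locales (use P X hsym h2 in \<open>auto simp: vec_ext nmat_mv axis_nth transpose_eq_iff
        Transposition.transpose_def\<close>)
  define a where "a = (X *v nu) $ P"
  have nu: "X *v nu = a *\<^sub>R nu" unfolding a_def by (rule ricci_flat_nu[OF rf])
  show ?thesis
  proof (cases "a = 0")
    case True
    then show ?thesis using null_flat[OF _ rf] nu by simp
  next
    case False
    \<comment> \<open>Scaling tau by a and nu by 1/a preserves the form, in which these two pair
      only with each other. As x_T is multiplied by a, X is conjugated and divided by a, and its
      eigenvalue on nu becomes 1.\<close>
    define c where "c = (\<lambda>i. if i = T then a else if i = P then 1 / a else 1)"
    define L where "L = (\<chi> i j. if i = j then c i else 0)"
    define K where "K = (\<chi> i j. if i = j then 1 / c i else 0)"
    have L: "(L *v v) $ i = c i * v $ i" and K: "(K *v v) $ i = v $ i / c i" for v i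
      by (simp_all add: L_def K_def matrix_vector_mult_def if_distrib[of "\<lambda>x. x * _"] cong: if_cong)
    have c: "c i \<noteq> 0" for i using False by (simp add: c_def)
    have KL: "K *v (L *v v) = v" for v using c by (simp add: vec_ext L K)
    define X' where "X' = (1 / a) *\<^sub>R (L ** X ** K)"
    have X': "X' *v v = (1 / a) *\<^sub>R (L *v (X *v (K *v v)))" for v
      by (simp add: X'_def mv_simps)
    have Ktau: "K *v tau = (1 / a) *\<^sub>R tau" and Knu: "K *v nu = a *\<^sub>R nu" and Lnu: "L *v nu = (1 / a) *\<^sub>R nu"
      using P by (auto simp: vec_ext K L axis_nth c_def)
    have "isometric (gmet T (nmat T P) X) (gmet T (nmat T P) X')"
    proof (rule isometric_gmet[OF h2])
      have tL: "tp L = L" by (auto simp: L_def vec_ext Finite_Cartesian_Product.transpose_def)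
      have cc: "c i * c (Transposition.transpose T P i) = 1" for i
        using False P by (auto simp: c_def Transposition.transpose_def)
      show "tp L ** nmat T P ** L = nmat T P"
        unfolding tL matrix_eq by (simp add: mv_assoc vec_ext L nmat_mv) (simp add: cc flip: mult.assoc)
      show "L ** X = a *\<^sub>R (X' ** L)"
        unfolding matrix_eq using False by (simp add: mv_simps X' KL)
      show "(L *v x) $ T = a * x $ T" for x by (simp add: L c_def)
    qed
    moreover have "X' *v tau = 0" "X' *v nu = nu" "\<forall>v. (X' *v v) $ T = 0"
      using False by (simp_all add: X' Ktau Knu Lnu mv_scaleR X nu L)
    ultimately show ?thesis by blast
  qed
qed

section \<open>Matrices over a numbered finite type\<close>

declare One_nat_def [simp del] and diag_block_mat.simps(2) [simp del]

lemma diag_block_mat_pair: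
  "diag_block_mat [A, B] = four_block_mat A (0\<^sub>m (dim_row A) (dim_col B)) (0\<^sub>m (dim_row B) (dim_col A)) B"
  by (simp add: diag_block_mat.simps(2)[of A] Let_def)

locale numbering =
  fixes idx :: "'n::finite \<Rightarrow> nat" and n :: nat
  assumes bij: "bij_betw idx UNIV {0..<n}" and card: "n \<ge> 4" and CARD_n: "CARD('n) = n"
begin

definition coord where "coord = inv_into UNIV idx"

abbreviation T where "T \<equiv> coord (n - 1)"

lemma coord_idx [simp]: "coord (idx i) = i"
  unfolding coord_def using bij by (simp add: bij_betw_def)

lemma idx_coord [simp]: "k < n \<Longrightarrow> idx (coord k) = k"
  unfolding coord_def using bij by (intro f_inv_into_f) (auto simp: bij_betw_def)

lemma idx_less [simp]: "idx i < n"
  using bij by (auto simp: bij_betw_def)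

lemma idx_eq_iff [simp]: "idx i = idx j \<longleftrightarrow> i = j"
  by (metis coord_idx)

lemma eq_coord_iff: "k < n \<Longrightarrow> i = coord k \<longleftrightarrow> idx i = k"
  by auto

lemma idx_less_T: "idx i < n - 1 \<longleftrightarrow> i \<noteq> T"
proof -
  have "i = T \<longleftrightarrow> idx i = n - 1" using card by (intro eq_coord_iff) simp
  then show ?thesis using card idx_less[of i] by linarith
qed

lemma sum_idx: "(\<Sum>k = 0..<n. f k) = (\<Sum>i\<in>UNIV. f (idx i))"
  by (rule sum.reindex_bij_betw[OF bij, symmetric])

lemma sum_idx_T: "(\<Sum>k = 0..<n - 1. f k) = (\<Sum>i\<in>UNIV - {T}. f (idx i))"
proof -
  have "bij_betw idx (UNIV - {T}) {0..<n - 1}"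
  proof (rule bij_betwI[of _ _ _ coord])
    show "idx \<in> UNIV - {T} \<rightarrow> {0..<n - 1}" using idx_less_T by auto
    show "coord \<in> {0..<n - 1} \<rightarrow> UNIV - {T}"
    proof
      fix k assume "k \<in> {0..<n - 1}"
      then have "idx (coord k) < n - 1" by simp
      then show "coord k \<in> UNIV - {T}" using idx_less_T by blast
    qed
  qed auto
  from sum.reindex_bij_betw[OF this] show ?thesis by (rule sym)
qed

definition vmat :: "real mat \<Rightarrow> real ^ 'n ^ 'n" where
  "vmat B = (\<chi> i j. B $$ (idx i, idx j))"

definition xmat :: "real mat \<Rightarrow> real ^ 'n ^ 'n" where
  "xmat A = (\<chi> i j. if i \<noteq> T \<and> j \<noteq> T then A $$ (idx i, idx j) else 0)"

lemma vmat_mult: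
  assumes "A \<in> carrier_mat n n" "B \<in> carrier_mat n n"
  shows "vmat (A * B) = vmat A ** vmat B"
proof (rule mat_eqI)
  fix i j
  have "(A * B) $$ (idx i, idx j) = (\<Sum>k = 0..<n. A $$ (idx i, k) * B $$ (k, idx j))"
    using assms by (simp add: scalar_prod_def)
  then show "vmat (A * B) $ i $ j = (vmat A ** vmat B) $ i $ j"
    by (simp add: sum_idx vmat_def matrix_matrix_mult_def)
qed

lemma xmat_T: "xmat A *v axis T 1 = 0" "(xmat A *v v) $ T = 0"
  by (simp add: vec_ext matrix_vector_mult_basis column_def xmat_def)
    (simp add: matrix_vector_mult_def xmat_def)

lemma xmat_transpose: "A \<in> carrier_mat (n - 1) (n - 1) \<Longrightarrow> xmat (transpose_mat A) = tp (xmat A)"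
  by (auto simp: xmat_def Finite_Cartesian_Product.transpose_def vec_ext index_transpose_mat idx_less_T)

lemma mpow_Suc_right: "mpow X (Suc k) = mpow X k ** X"
  by (induction k) (simp_all add: matrix_mul_assoc)

text \<open>Row T of \<open>xmat A\<close> is zero, so the index T contributes nothing to the
  products, and on the remaining indices they agree with those of A.\<close>

lemma mpow_xmat:
  assumes A: "A \<in> carrier_mat (n - 1) (n - 1)" and "i \<noteq> T" "j \<noteq> T"
  shows "((c \<cdot>\<^sub>m A) ^\<^sub>m k) $$ (idx i, idx j) = c ^ k * mpow (xmat A) k $ i $ j"
  using assms(3)
proof (induction k arbitrary: j)
  case 0
  then show ?case using A assms(2) idx_less_T by (simp add: Finite_Cartesian_Product.mat_def)
next
  case (Suc k)
  have B: "c \<cdot>\<^sub>m A \<in> carrier_mat (n - 1) (n - 1)" using A by simp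
  have lt: "idx i < n - 1" "idx j < n - 1" using assms(2) Suc(2) idx_less_T by auto
  have "((c \<cdot>\<^sub>m A) ^\<^sub>m Suc k) $$ (idx i, idx j) =
    (\<Sum>m = 0..<n - 1. ((c \<cdot>\<^sub>m A) ^\<^sub>m k) $$ (idx i, m) * (c * A $$ (m, idx j)))"
    using lt A pow_carrier_mat[OF B, of k] by (simp add: scalar_prod_def)
  also have "\<dots> = (\<Sum>m\<in>UNIV - {T}. c ^ k * mpow (xmat A) k $ i $ m * (c * xmat A $ m $ j))"
    unfolding sum_idx_T by (intro sum.cong refl) (use Suc in \<open>simp add: xmat_def\<close>)
  also have "\<dots> = (\<Sum>m\<in>UNIV. c ^ k * mpow (xmat A) k $ i $ m * (c * xmat A $ m $ j))"
    by (intro sum.mono_neutral_left) (auto simp: xmat_def)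
  also have "\<dots> = c ^ Suc k * mpow (xmat A) (Suc k) $ i $ j"
    unfolding mpow_Suc_right by (simp add: matrix_matrix_mult_def sum_distrib_left mult_ac)
  finally show ?case .
qed

text \<open>The identity form gives access to \<open>E_T\<close> and \<open>E_tau\<close>, which
  concern exponentials only.\<close>

lemma left_invariant_xmat: "left_invariant (xmat A) idm T"
  by unfold_locales (simp_all add: xmat_T)

lemma expand_carrier: "B \<in> carrier_mat (n - 1) (n - 1) \<Longrightarrow> expand B \<in> carrier_mat n n"
  unfolding expand_def using card by (intro carrier_matI) (auto simp: dim_diag_block_mat)

lemma vmat_expand:
  assumes "B \<in> carrier_mat (n - 1) (n - 1)"
  shows "vmat (expand B) $ i $ j = (if i \<noteq> T \<and> j \<noteq> T then B $$ (idx i, idx j) else if i = j then 1 else 0)"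
proof -
  have e: "expand B = four_block_mat B (0\<^sub>m (n - 1) 1) (0\<^sub>m 1 (n - 1)) (1\<^sub>m 1)"
    using assms by (simp add: expand_def diag_block_mat_pair)
  have "idx i < Suc (n - 1)" "idx j < Suc (n - 1)" using card by auto
  then show ?thesis
    using assms card idx_less_T[of i] idx_less_T[of j] idx_less[of i] idx_less[of j] by (auto simp: vmat_def e)
qed

lemma mat_exp_carrier: "A \<in> carrier_mat m m \<Longrightarrow> mat_exp A \<in> carrier_mat m m"
  by (simp add: mat_exp_def)

lemma vmat_expand_mat_exp:
  assumes A: "A \<in> carrier_mat (n - 1) (n - 1)"
  shows "vmat (expand (mat_exp (c \<cdot>\<^sub>m A))) = mexp (xmat A) c"
proof (rule mat_eqI)
  fix i j
  interpret left_invariant "xmat A" idm T by (rule left_invariant_xmat)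
  have c: "mat_exp (c \<cdot>\<^sub>m A) \<in> carrier_mat (n - 1) (n - 1)" using A by (intro mat_exp_carrier) simp
  show "vmat (expand (mat_exp (c \<cdot>\<^sub>m A))) $ i $ j = mexp (xmat A) c $ i $ j"
  proof (cases "i \<noteq> T \<and> j \<noteq> T")
    case True
    then have lt: "idx i < n - 1" "idx j < n - 1" using idx_less_T by auto
    have "mat_exp (c \<cdot>\<^sub>m A) $$ (idx i, idx j) = (\<Sum>k. ((c \<cdot>\<^sub>m A) ^\<^sub>m k) $$ (idx i, idx j) / fact k)"
      using A lt by (simp add: mat_exp_def)
    also have "\<dots> = (\<Sum>k. mcoef (xmat A) k $ i $ j * c ^ k)"
      using mpow_xmat[OF A] True by (simp add: mcoef_def mult.commute)
    finally show ?thesis using True by (simp add: vmat_expand[OF c] mexp_def)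
  next
    case False
    \<comment> \<open>By \<open>E_T\<close> and \<open>E_tau\<close>, row and column T of the
      exponential are those of the identity, as in \<open>expand\<close>.\<close>
    then consider "i = T" | "j = T" "i \<noteq> T" by blast
    then show ?thesis
    proof cases
      case 1
      then show ?thesis
        using E_T[of c "axis j 1"] by (simp add: vmat_expand[OF c] matrix_vector_mult_basis column_def axis_nth)
    next
      case 2
      then show ?thesis
        using arg_cong[OF E_tau[of c], of "\<lambda>v. v $ i"]
        by (simp add: vmat_expand[OF c] matrix_vector_mult_basis column_def axis_nth)
    qed
  qed
qed

lemma metric_of_gmet:
  assumes A: "A \<in> carrier_mat (n - 1) (n - 1)" and eta: "\<eta> \<in> carrier_mat n n"
  shows "metric_of idx A \<eta> = gmet T (vmat \<eta>) (xmat A)"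
proof
  fix x :: "real ^ 'n"
  let ?t = "- (x $ T)"
  let ?E = "expand (mat_exp (?t \<cdot>\<^sub>m A))" and ?F = "expand (mat_exp (?t \<cdot>\<^sub>m transpose_mat A))"
  have c: "?E \<in> carrier_mat n n" "?F \<in> carrier_mat n n"
    using A by (auto intro!: expand_carrier mat_exp_carrier)
  have "metric_of idx A \<eta> x = vmat (?F * \<eta> * ?E)"
    by (simp add: metric_of_def vmat_def coord_def Let_def CARD_n)
  also have "\<dots> = vmat ?F ** vmat \<eta> ** vmat ?E"
    using c eta by (simp add: vmat_mult mult_carrier_mat[of _ n n] matrix_mul_assoc)
  also have "vmat ?E = mexp (xmat A) ?t" by (rule vmat_expand_mat_exp[OF A])
  also have "vmat ?F = tp (mexp (xmat A) ?t)"
    using A by (subst vmat_expand_mat_exp) (auto simp: xmat_transpose mexp_transpose)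
  finally show "metric_of idx A \<eta> x = gmet T (vmat \<eta>) (xmat A) x" by (simp add: gmet_def)
qed

lemma eta_carrier: "eta_a n \<in> carrier_mat n n" "eta_b n \<in> carrier_mat n n" "eta_c n \<in> carrier_mat n n"
proof -
  show "eta_c n \<in> carrier_mat n n"
    unfolding eta_c_def using card by (intro carrier_matI) (auto simp: dim_diag_block_mat mat_of_rows_list_def)
qed (simp_all add: eta_a_def eta_b_def)

lemma vmat_eta_a: "vmat (eta_a n) = lmat T"
  using card by (intro mat_eqI) (auto simp: vmat_def eta_a_def lmat_def mat_diag_def sg_def eq_coord_iff)

lemma vmat_eta_b: "vmat (eta_b n) = lmat (coord 0)"
  using card by (intro mat_eqI) (auto simp: vmat_def eta_b_def lmat_def mat_diag_def sg_def eq_coord_iff)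

lemma vmat_eta_c: "vmat (eta_c n) = nmat T (coord (n - 2))"
proof (rule mat_eqI)
  fix i j
  have e: "eta_c n = four_block_mat (1\<^sub>m (n - 2)) (0\<^sub>m (n - 2) 2) (0\<^sub>m 2 (n - 2)) (mat_of_rows_list 2 [[0, 1], [1, 0]])"
    by (simp add: eta_c_def diag_block_mat_pair mat_of_rows_list_def numeral_2_eq_2)
  have cases: "idx k < n - 2 \<or> idx k = n - 2 \<or> idx k = n - 1" for k
    using idx_less[of k] by linarith
  have T: "k = T \<longleftrightarrow> idx k = n - 1" "k = coord (n - 2) \<longleftrightarrow> idx k = n - 2" for k
    using card eq_coord_iff[of "n - 1" k] eq_coord_iff[of "n - 2" k] by auto
  have s: "n - 2 + 2 = n" "n - 1 - (n - 2) = Suc 0" "n - 1 \<noteq> n - 2" using card by auto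
  have swap: "idx (Transposition.transpose T (coord (n - 2)) i) =
     (if idx i = n - 1 then n - 2 else if idx i = n - 2 then n - 1 else idx i)"
    using card T by (auto simp: Transposition.transpose_def)
  have "vmat (eta_c n) $ i $ j = (if idx j = (if idx i = n - 1 then n - 2 else if idx i = n - 2 then n - 1 else idx i) then 1 else 0)"
    using cases[of i] cases[of j] card s by (auto simp: vmat_def e mat_of_rows_list_def)
  also have "\<dots> = (if idx j = idx (Transposition.transpose T (coord (n - 2)) i) then 1 else 0)"
    by (simp only: swap)
  finally show "vmat (eta_c n) $ i $ j = nmat T (coord (n - 2)) $ i $ j"
    by (simp add: nmat_def)
qed


lemma coord_distinct:
  "j < n \<Longrightarrow> k < n \<Longrightarrow> coord j = coord k \<longleftrightarrow> j = k"
  by (metis idx_coord)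

lemma listed_1_rot_form:
  assumes "a \<le> 0" "b > 0"
  obtains A where "A \<in> carrier_mat (n - 1) (n - 1)" "listed_1 n (eta_b n) A"
    "xmat A = rot_form (coord 0) (coord 1) T a b lam"
proof
  let ?B = "mat_of_rows_list 2 [[a, - b], [b, a]]"
  \<comment> \<open>The entry at position i of this block has position i + 2 in A, counted from 0,
    whereas \<open>listed_1\<close> numbers it i + 3, counted from 1; hence the shift by
    one.\<close>
  define D where "D = mat_diag (n - 3) (\<lambda>i. lam (coord (i + 3 - 1)))"
  let ?A = "diag_block_mat [?B, D]"
  have B: "?B \<in> carrier_mat 2 2" by (simp add: mat_of_rows_list_def numeral_2_eq_2)
  have D: "D \<in> carrier_mat (n - 3) (n - 3)" by (simp add: D_def)
  have n: "2 + (n - 3) = n - 1" using card by simp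
  have A: "?A = four_block_mat ?B (0\<^sub>m 2 (n - 3)) (0\<^sub>m (n - 3) 2) D"
    using B D by (simp add: diag_block_mat_pair)
  show "?A \<in> carrier_mat (n - 1) (n - 1)"
    using four_block_carrier_mat[OF B D] unfolding A n .
  show "listed_1 n (eta_b n) ?A"
    unfolding listed_1_def D_def
    by (intro conjI refl exI[of _ a] exI[of _ b] exI[of _ "\<lambda>k. lam (coord (k - 1))"] assms)
  show "xmat ?A = rot_form (coord 0) (coord 1) T a b lam"
  proof (rule mat_eqI)
    fix i j
    have c: "k = coord 0 \<longleftrightarrow> idx k = 0" "k = coord 1 \<longleftrightarrow> idx k = 1" "k = T \<longleftrightarrow> idx k = n - 1" for k
      using card eq_coord_iff by auto
    have Bij: "?B $$ (k, l) = (if k = 0 then if l = 0 then a else - b else if l = 0 then b else a)"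
      if "k < 2" "l < 2" for k l
      using that by (auto simp: mat_of_rows_list_def less_Suc_eq numeral_2_eq_2)
    have Dij: "D $$ (k - 2, l - 2) = (if k = l then lam (coord k) else 0)"
      if "2 \<le> k" "2 \<le> l" "k < n - 1" "l < n - 1" for k l
    proof -
      have "l - 2 + 3 - 1 = l" using that by simp
      then show ?thesis using that by (auto simp: D_def mat_diag_def simp del: add_diff_assoc2)
    qed
    have Aij: "?A $$ (k, l) = (if l = 0 then (if k = 0 then a else if k = 1 then b else 0)
        else if l = 1 then (if k = 0 then - b else if k = 1 then a else 0)
        else if k = l then lam (coord l) else 0)" if "k < n - 1" "l < n - 1" for k l
    proof -
      consider "k < 2" "l < 2" | "k < 2" "2 \<le> l" | "2 \<le> k" "l < 2" | "2 \<le> k" "2 \<le> l" by linarith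
      then show ?thesis
      proof cases
        case 1
        then show ?thesis using that B D n unfolding A
          by (subst index_mat_four_block) (auto simp: Bij)
      next
        case 4
        then show ?thesis using that B D n unfolding A
          by (subst index_mat_four_block) (auto simp: Dij)
      qed (use that B D n in \<open>unfold A, subst index_mat_four_block, auto\<close>)
    qed
    have cn: "idx k < n - 1 \<or> idx k = n - 1" for k using idx_less[of k] by linarith
    have "xmat ?A $ i $ j = (if idx i < n - 1 \<and> idx j < n - 1 then ?A $$ (idx i, idx j) else 0)"
      by (simp add: xmat_def idx_less_T)
    also have "\<dots> = rot_form (coord 0) (coord 1) T a b lam $ i $ j"
      using cn[of i] cn[of j] card by (auto simp: Aij rot_form_def c)
    finally show "xmat ?A $ i $ j = rot_form (coord 0) (coord 1) T a b lam $ i $ j" .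
  qed
qed

lemma listed_2_nil_form:
  obtains A where "A \<in> carrier_mat (n - 1) (n - 1)" "listed_2 n (eta_b n) A"
    "xmat A = nil_form (coord 0) (coord 1) (coord 2) d"
proof
  let ?B = "mat_of_rows_list 3 [[- d, - d, - 1], [d, d, 1], [1, 1, 0]]"
  let ?A = "diag_block_mat [?B, 0\<^sub>m (n - 4) (n - 4)]"
  have B: "?B \<in> carrier_mat 3 3" by (simp add: mat_of_rows_list_def numeral_3_eq_3)
  have n: "3 + (n - 4) = n - 1" using card by simp
  have A: "?A = four_block_mat ?B (0\<^sub>m 3 (n - 4)) (0\<^sub>m (n - 4) 3) (0\<^sub>m (n - 4) (n - 4))"
    using B by (simp add: diag_block_mat_pair)
  show "?A \<in> carrier_mat (n - 1) (n - 1)"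
    using four_block_carrier_mat[OF B zero_carrier_mat[of "n - 4" "n - 4"]] unfolding A n .
  show "listed_2 n (eta_b n) ?A"
    unfolding listed_2_def by (intro conjI refl exI[of _ d])
  show "xmat ?A = nil_form (coord 0) (coord 1) (coord 2) d"
  proof (rule mat_eqI)
    fix i j
    have c: "k = coord 0 \<longleftrightarrow> idx k = 0" "k = coord 1 \<longleftrightarrow> idx k = 1" "k = coord 2 \<longleftrightarrow> idx k = 2" for k
      using card eq_coord_iff by auto
    have Bij: "?B $$ (k, l) = (if l = 0 \<or> l = 1 then (if k = 0 then - d else if k = 1 then d else 1)
        else if k = 0 then - 1 else if k = 1 then 1 else 0)"
      if "k < 3" "l < 3" for k l
      using that by (auto simp: mat_of_rows_list_def less_Suc_eq numeral_3_eq_3 One_nat_def)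
    have Aij: "?A $$ (k, l) = (if l = 0 \<or> l = 1 then (if k = 0 then - d else if k = 1 then d else if k = 2 then 1 else 0)
        else if l = 2 then (if k = 0 then - 1 else if k = 1 then 1 else 0) else 0)"
      if "k < n - 1" "l < n - 1" for k l
    proof -
      have "k < 3 \<Longrightarrow> k \<in> {0, 1, 2}" "l < 3 \<Longrightarrow> l \<in> {0, 1, 2}" by auto
      then show ?thesis using that B n unfolding A
        by (subst index_mat_four_block) (auto simp: Bij)
    qed
    have cn: "idx k < n - 1 \<or> idx k = n - 1" for k using idx_less[of k] by linarith
    have "xmat ?A $ i $ j = (if idx i < n - 1 \<and> idx j < n - 1 then ?A $$ (idx i, idx j) else 0)"
      by (simp add: xmat_def idx_less_T)
    also have "\<dots> = nil_form (coord 0) (coord 1) (coord 2) d $ i $ j"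
      using cn[of i] cn[of j] card by (auto simp: Aij nil_form_def c)
    finally show "xmat ?A $ i $ j = nil_form (coord 0) (coord 1) (coord 2) d $ i $ j" .
  qed
qed

lemma listed_3_null_eigenvector:
  assumes X: "X *v axis T 1 = 0" "\<And>v. (X *v v) $ T = 0" "X *v axis (coord (n - 2)) 1 = axis (coord (n - 2)) 1"
  obtains A where "A \<in> carrier_mat (n - 1) (n - 1)" "listed_3 n (eta_c n) A" "xmat A = X"
proof
  let ?P = "coord (n - 2)"
  define A where "A = Matrix.mat (n - 1) (n - 1) (\<lambda>(i, j). X $ coord i $ coord j)"
  have col: "X $ i $ T = 0" "X $ i $ ?P = (if i = ?P then 1 else 0)" for i
    using arg_cong[OF X(1), of "\<lambda>v. v $ i"] arg_cong[OF X(3), of "\<lambda>v. v $ i"]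
    by (auto simp: matrix_vector_mult_basis column_def axis_nth)
  have row: "X $ T $ j = 0" for j
    using X(2)[of "axis j 1"] by (simp add: matrix_vector_mult_basis column_def)
  show "A \<in> carrier_mat (n - 1) (n - 1)" by (simp add: A_def)
  show "xmat A = X"
    by (rule mat_eqI) (use idx_less_T col row in \<open>auto simp: xmat_def A_def\<close>)
  define A' where "A' = Matrix.mat (n - 2) (n - 2) (\<lambda>(i, j). X $ coord i $ coord j)"
  \<comment> \<open>P is the last index of A: its row supplies c and the corner entry 1, and its
    column is a unit vector because X fixes the basis vector at P.\<close>
  define c where "c = Matrix.vec (n - 2) (\<lambda>j. X $ ?P $ coord j)"
  have s: "n - 1 = n - 2 + 1" using card by simp
  have "A = four_block_mat A' (0\<^sub>m (n - 2) 1) (mat_of_rows (n - 2) [c]) (1\<^sub>m 1)"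
  proof (rule eq_matI)
    fix i j
    assume "i < dim_row (four_block_mat A' (0\<^sub>m (n - 2) 1) (mat_of_rows (n - 2) [c]) (1\<^sub>m 1))"
      "j < dim_col (four_block_mat A' (0\<^sub>m (n - 2) 1) (mat_of_rows (n - 2) [c]) (1\<^sub>m 1))"
    then have ij: "i < n - 2 + 1" "j < n - 2 + 1" by (simp_all add: A'_def)
    then have "i < n - 2 \<or> i = n - 2" "j < n - 2 \<or> j = n - 2" by auto
    then show "A $$ (i, j) = four_block_mat A' (0\<^sub>m (n - 2) 1) (mat_of_rows (n - 2) [c]) (1\<^sub>m 1) $$ (i, j)"
      using ij card by (auto simp: A_def s A'_def c_def mat_of_rows_index col coord_distinct)
  qed (simp_all add: A_def A'_def s)
  then show "listed_3 n (eta_c n) A"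
    unfolding listed_3_def by (intro conjI refl exI[of _ A'] exI[of _ c]) (simp_all add: A'_def c_def)
qed

lemma isometric_to_listedI:
  assumes "A \<in> carrier_mat (n - 1) (n - 1)" "\<eta> \<in> carrier_mat n n"
    and "A' \<in> carrier_mat (n - 1) (n - 1)" "\<eta>' \<in> carrier_mat n n"
    and "listed_1 n \<eta>' A' \<or> listed_2 n \<eta>' A' \<or> listed_3 n \<eta>' A'"
    and "isometric (gmet T (vmat \<eta>) (xmat A)) (gmet T (vmat \<eta>') (xmat A'))"
  shows "isometric_to_listed idx A \<eta>"
  unfolding isometric_to_listed_def CARD_n
  using assms by (intro exI[of _ A'] exI[of _ \<eta>']) (simp add: metric_of_gmet)

lemma flat_or_isometric_to_listed:
  assumes A: "A \<in> carrier_mat (n - 1) (n - 1)" and eta: "\<eta> \<in> {eta_a n, eta_b n, eta_c n}"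
    and rf: "ricci_flat (metric_of idx A \<eta>)"
  shows "flat (metric_of idx A \<eta>) \<or> isometric_to_listed idx A \<eta>"
proof -
  note eq = metric_of_gmet[OF A]
  consider "\<eta> = eta_a n" | "\<eta> = eta_b n" | "\<eta> = eta_c n" using eta by blast
  then show ?thesis
  proof cases
    case 1
    then show ?thesis
      using rf ricci_flat_timelike_direction[OF xmat_T] by (simp add: eq eta_carrier vmat_eta_a)
  next
    case 2
    have d: "T \<noteq> coord 0" "coord 1 \<noteq> coord 0" "coord 1 \<noteq> T" "coord 2 \<notin> {coord 0, coord 1, T}"
      using card by (simp_all add: coord_distinct)
    have g: "metric_of idx A \<eta> = gmet T (lmat (coord 0)) (xmat A)"
      by (simp add: 2 eq eta_carrier vmat_eta_b)
    note I = isometric_to_listedI[OF A eta_carrier(2) _ eta_carrier(2), folded 2, unfolded 2 vmat_eta_b]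
    from ricci_flat_spacelike_direction[OF xmat_T rf[unfolded g] d]
    consider "flat (gmet T (lmat (coord 0)) (xmat A))"
      | a b lam where "a \<le> 0" "b > 0" "isometric (gmet T (lmat (coord 0)) (xmat A))
          (gmet T (lmat (coord 0)) (rot_form (coord 0) (coord 1) T a b lam))"
      | e where "isometric (gmet T (lmat (coord 0)) (xmat A))
          (gmet T (lmat (coord 0)) (nil_form (coord 0) (coord 1) (coord 2) e))"
      by blast
    then show ?thesis
    proof cases
      case 1
      then show ?thesis by (simp add: g)
    next
      case (2 a b lam)
      obtain A' where "A' \<in> carrier_mat (n - 1) (n - 1)" "listed_1 n (eta_b n) A'"
        "xmat A' = rot_form (coord 0) (coord 1) T a b lam"
        by (rule listed_1_rot_form[OF 2(1,2)])
      then show ?thesis using I[of A'] 2(3) \<open>\<eta> = eta_b n\<close> by simp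
    next
      case (3 e)
      obtain A' where "A' \<in> carrier_mat (n - 1) (n - 1)" "listed_2 n (eta_b n) A'"
        "xmat A' = nil_form (coord 0) (coord 1) (coord 2) e"
        by (rule listed_2_nil_form)
      then show ?thesis using I[of A'] 3 \<open>\<eta> = eta_b n\<close> by simp
    qed
  next
    case 3
    have P: "coord (n - 2) \<noteq> T" using card by (simp add: coord_distinct)
    have g: "metric_of idx A \<eta> = gmet T (nmat T (coord (n - 2))) (xmat A)"
      by (simp add: 3 eq eta_carrier vmat_eta_c)
    from ricci_flat_null_direction[OF xmat_T rf[unfolded g] P]
    consider "flat (gmet T (nmat T (coord (n - 2))) (xmat A))"
      | X' where "X' *v axis T 1 = 0" "\<And>v. (X' *v v) $ T = 0" "X' *v axis (coord (n - 2)) 1 = axis (coord (n - 2)) 1"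
        "isometric (gmet T (nmat T (coord (n - 2))) (xmat A)) (gmet T (nmat T (coord (n - 2))) X')"
      by blast
    then show ?thesis
    proof cases
      case 1
      then show ?thesis by (simp add: g)
    next
      case (2 X')
      obtain A' where "A' \<in> carrier_mat (n - 1) (n - 1)" "listed_3 n (eta_c n) A'" "xmat A' = X'"
        by (rule listed_3_null_eigenvector[OF 2(1-3)])
      then show ?thesis
        using isometric_to_listedI[OF A eta_carrier(3) _ eta_carrier(3), of A'] 2(4) 3
        by (simp add: vmat_eta_c)
    qed
  qed
qed

end

theorem proposition3p7:
  fixes n :: nat and idx :: "'n::finite \<Rightarrow> nat" and A \<eta> :: "real mat"
  assumes "n \<ge> 4"
    and "CARD('n) = n" and "bij_betw idx UNIV {0..<n}"
    and "A \<in> carrier_mat (n - 1) (n - 1)"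
    and "\<eta> \<in> {eta_a n, eta_b n, eta_c n}"
    and "ricci_flat (metric_of idx A \<eta>)"
  shows "(\<not> flat (metric_of idx A \<eta>) \<longrightarrow> isometric_to_listed idx A \<eta>) \<and>
         (\<not> isometric_to_listed idx A \<eta> \<longrightarrow> flat (metric_of idx A \<eta>))"
proof -
  interpret numbering idx n
    by unfold_locales (use assms in auto)
  \<comment> \<open>Both implications are readings of the same disjunction.\<close>
  show ?thesis using flat_or_isometric_to_listed assms(4-6) by blast
qed

end
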